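(* Let $G$ be a topological group, let $\pi$ be a unitary representation of $G$ on a Hilbert space $\mathcal H$, let $b\in Z^1(G,\pi)$ be a 1-cocycle which is not a 1-coboundary, let $\alpha(g)v=\pi(g)v+b(g)$ be the associated affine isometric action of $G$ on $\mathcal H$, and let $\psi(g)=\|b(g)\|^2$ be the associated function conditionally of negative type. The following properties are equivalent: (A1) The affine isometric action $\alpha$ is irreducible. (A2) For every $v\in\mathcal H$, the 1-cocycle $b+\partial_v$, i.e. $g\mapsto b(g)+\pi(g)v-v$, has total image in $\mathcal H$. (A3) For every direct sum decomposition $\pi=\pi_0\oplus\pi_1$ with $\pi_0\neq 0$, in the corresponding decomposition $b=b_0\oplus b_1$, the 1-cocycle $b_0$ is unbounded. (A4) $b(G)$ is total and, for every decomposition $\psi=\psi_0+\psi_1$, with $\psi_0,\psi_1$ functions conditionally of negative type on $G$ with $\psi_0\neq 0$, the function $\psi_0$ is unbounded. (A5) $b(G)$ is total and $\psi$ belongs to a common face of $C$ and $C_u$. (A6) For every non-zero sub-representation $\pi_0$ of $\pi$, the projected action $\alpha_0$ is irreducible.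
   Context: Representations, cocycles and actions are continuous. $Z^1(G,\pi)$ is the space of 1-cocycles, i.e. continuous maps $b:G\to\mathcal H$ with $b(gh)=b(g)+\pi(g)b(h)$; a 1-coboundary is a map of the form $\partial_v(g)=\pi(g)v-v$ with $v\in\mathcal H$. An affine isometric action $\alpha$ of $G$ on $\mathcal H$ is irreducible if $\mathcal H$ has no non-empty, closed and proper $\alpha(G)$-invariant affine subspace. A subset of $\mathcal H$ is total if it generates a dense linear subspace of $\mathcal H$. If $\pi_0$ is a sub-representation of $\pi$ on a closed subspace $V_0\subset\mathcal H$, and $b_0(g)$ denotes the orthogonal projection of $b(g)$ on $V_0$, then $b_0$ is a 1-cocycle for $\pi_0$, and the projected action $\alpha_0$ on $V_0$ is $\alpha_0(g)v=\pi_0(g)v+b_0(g)$. A continuous function $\psi:G\to\mathbf R$ is conditionally of negative type if $\psi(e)=0$ (with $e$ the identity of $G$), $\psi(g^{-1})=\psi(g)$ for all $g\in G$ and, for all $n\ge 1$, $g_1,\dots,g_n\in G$ and $\lambda_1,\dots,\lambda_n\in\mathbf R$ with $\sum_i\lambda_i=0$, one has $\sum_{i,j}\lambda_i\lambda_j\psi(g_i^{-1}g_j)\le 0$; equivalently, there is a continuous affine isometric action $\alpha_\psi$ of $G$ on some Hilbert space with $\psi(g)=\|\alpha_\psi(g)(0)\|^2$ for every $g\in G$. $C$ is the convex cone of all functions conditionally of negative type on $G$, and $C_u\subset C$ is the sub-cone consisting of the unbounded functions in $C$ together with $0$. A face of a convex cone $K$ is a convex sub-cone $F\subset K$ such that $x,y\in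 K$ and $x+y\in F$ imply $x,y\in F$.
   Formalization: Hilbert spaces are real, with real affine subspaces, spans and sub-representations; with complex-linear notions (A1) does not imply (A4), e.g. F_2 acting on C^3 through a dense subgroup of SO(3) with b = b' + i∂_v, b' a real cocycle that is not a coboundary. *)

theory Defs
  imports "HOL-Analysis.Analysis"
begin

(* Groups are written additively, as in the library class topological_group_add,
   but are not assumed commutative: g + h is the product, 0 the identity and - g the inverse.

   Hilbert spaces are real, of arbitrary dimension, so a unitary representation is one by
   surjective real-linear isometries, and affine subspaces, spans and sub-representations are
   taken over the reals.  This is forced by the real-valued functions conditionally of negative
   type: over the complex numbers (complex affine subspaces, complex spans) the equivalence
   fails.  Let G act irreducibly on the complexification of a real Hilbert space by extending
   an orthogonal representation pi, let b' be a non-trivial real cocycle and let v be a real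
   vector that is not fixed.  Then b = b' + i (pi v - v) gives an action with no proper
   complex invariant affine subspace, while |b|^2 = |b'|^2 + |pi v - v|^2 has a non-zero
   bounded summand.  A complex Hilbert space is covered through its underlying real
   Hilbert space. *)

(* Surjectivity of each operator follows from the group law; continuity is strong continuity. *)
definition unitary_rep ::
    "('g::topological_group_add \<Rightarrow> 'h::{real_inner,complete_space} \<Rightarrow> 'h) \<Rightarrow> bool" where
  "unitary_rep \<pi> \<longleftrightarrow>
     (\<forall>g. orthogonal_transformation (\<pi> g)) \<and>
     \<pi> 0 = id \<and>
     (\<forall>g h. \<pi> (g + h) = \<pi> g \<circ> \<pi> h) \<and>
     (\<forall>v. continuous_on UNIV (\<lambda>g. \<pi> g v))"

definition cocycles ::
    "('g::topological_group_add \<Rightarrow> 'h::{real_inner,complete_space} \<Rightarrow> 'h) \<Rightarrow> ('g \<Rightarrow> 'h) set" where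
  "cocycles \<pi> = {b. continuous_on UNIV b \<and> (\<forall>g h. b (g + h) = b g + \<pi> g (b h))}"

definition coboundary :: "('g \<Rightarrow> 'h \<Rightarrow> 'h) \<Rightarrow> 'h \<Rightarrow> 'g \<Rightarrow> 'h::real_inner" where
  "coboundary \<pi> v = (\<lambda>g. \<pi> g v - v)"

definition affine_action :: "('g \<Rightarrow> 'h \<Rightarrow> 'h) \<Rightarrow> ('g \<Rightarrow> 'h) \<Rightarrow> 'g \<Rightarrow> 'h \<Rightarrow> 'h::real_inner" where
  "affine_action \<pi> b = (\<lambda>g v. \<pi> g v + b g)"

(* Only the restriction of the action to V is relevant.  For V a closed subspace, the sets W
   closed in V are those closed in the whole space. *)
definition irreducible_action_on :: "'h::real_inner set \<Rightarrow> ('g \<Rightarrow> 'h \<Rightarrow> 'h) \<Rightarrow> bool" where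
  "irreducible_action_on V \<alpha> \<longleftrightarrow>
     \<not> (\<exists>W. W \<noteq> {} \<and> closed W \<and> affine W \<and> W \<subset> V \<and> (\<forall>g. \<alpha> g ` W \<subseteq> W))"

definition total_subset :: "'h::real_inner set \<Rightarrow> bool" where
  "total_subset S \<longleftrightarrow> closure (span S) = UNIV"

(* Sub-representations are identified with the closed invariant subspaces carrying them. *)
definition subrep :: "('g \<Rightarrow> 'h \<Rightarrow> 'h) \<Rightarrow> 'h::real_inner set \<Rightarrow> bool" where
  "subrep \<pi> V \<longleftrightarrow> subspace V \<and> closed V \<and> (\<forall>g. \<pi> g ` V \<subseteq> V)"

definition direct_sum_decomposition ::
    "('g \<Rightarrow> 'h \<Rightarrow> 'h) \<Rightarrow> 'h::real_inner set \<Rightarrow> 'h set \<Rightarrow> bool" where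
  "direct_sum_decomposition \<pi> V\<^sub>0 V\<^sub>1 \<longleftrightarrow>
     subrep \<pi> V\<^sub>0 \<and> subrep \<pi> V\<^sub>1 \<and>
     (\<forall>x\<in>V\<^sub>0. \<forall>y\<in>V\<^sub>1. orthogonal x y) \<and>
     (\<forall>z. \<exists>x\<in>V\<^sub>0. \<exists>y\<in>V\<^sub>1. z = x + y)"

(* Well defined when V is a closed subspace of a Hilbert space. *)
definition orth_proj :: "'h::real_inner set \<Rightarrow> 'h \<Rightarrow> 'h" where
  "orth_proj V x = (THE y. y \<in> V \<and> (\<forall>z\<in>V. orthogonal (x - y) z))"

definition projected_action ::
    "('g \<Rightarrow> 'h \<Rightarrow> 'h) \<Rightarrow> ('g \<Rightarrow> 'h) \<Rightarrow> 'h::real_inner set \<Rightarrow> 'g \<Rightarrow> 'h \<Rightarrow> 'h" where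
  "projected_action \<pi> b V = affine_action \<pi> (\<lambda>g. orth_proj V (b g))"

definition cond_neg_type :: "('g::topological_group_add \<Rightarrow> real) \<Rightarrow> bool" where
  "cond_neg_type \<psi> \<longleftrightarrow>
     continuous_on UNIV \<psi> \<and> \<psi> 0 = 0 \<and> (\<forall>g. \<psi> (- g) = \<psi> g) \<and>
     (\<forall>n\<ge>1. \<forall>(g :: nat \<Rightarrow> 'g) (l :: nat \<Rightarrow> real). (\<Sum>i<n. l i) = 0 \<longrightarrow>
        (\<Sum>i<n. \<Sum>j<n. l i * l j * \<psi> (- g i + g j)) \<le> 0)"

definition cone_C :: "('g::topological_group_add \<Rightarrow> real) set" where
  "cone_C = {\<psi>. cond_neg_type \<psi>}"

definition cone_Cu :: "('g::topological_group_add \<Rightarrow> real) set" where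
  "cone_Cu = {\<psi> \<in> cone_C. \<not> bounded (range \<psi>)} \<union> {\<lambda>_. 0}"

(* Pointwise version of the library's convex_cone, whose type class real_vector is not
   available for functions. *)
definition fun_convex_cone :: "('g \<Rightarrow> real) set \<Rightarrow> bool" where
  "fun_convex_cone K \<longleftrightarrow>
     K \<noteq> {} \<and>
     (\<forall>x\<in>K. \<forall>y\<in>K. (\<lambda>g. x g + y g) \<in> K) \<and>
     (\<forall>x\<in>K. \<forall>t\<ge>0. (\<lambda>g. t * x g) \<in> K)"

definition cone_face :: "('g \<Rightarrow> real) set \<Rightarrow> ('g \<Rightarrow> real) set \<Rightarrow> bool" where
  "cone_face F K \<longleftrightarrow>
     fun_convex_cone F \<and> F \<subseteq> K \<and>
     (\<forall>x\<in>K. \<forall>y\<in>K. (\<lambda>g. x g + y g) \<in> F \<longrightarrow> x \<in> F \<and> y \<in> F)"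

end

theory Submission
  imports Defs
begin

text \<open>An invariant affine subspace through \<open>v\<close> has as its direction a subspace containing the values of
  \<open>b + \<partial>\<^sub>v\<close>, which gives A2.  A bounded projection of \<open>b\<close> to a sub-representation has a fixed point,
  the Chebyshev centre of its values, and the preimage of the fixed point under the projection is an
  invariant affine subspace; conversely, on the orthogonal complement of the direction of an invariant
  affine subspace \<open>b\<close> projects to a coboundary.  This gives A3, and the same preimages give A6.

  For A4, a decomposition \<open>\<psi> = \<psi>\<^sub>0 + \<psi>\<^sub>1\<close> yields an operator \<open>0 \<le> A \<le> 1\<close> in the commutant of \<open>\<pi>\<close>
  with \<open>\<psi>\<^sub>0 g = \<langle>A b(g), b(g)\<rangle>\<close>.  A non-zero spectral subspace of \<open>A\<close> on which \<open>A \<ge> \<epsilon>\<close> is a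
  sub-representation, and the projection of \<open>b\<close> to it is bounded if \<open>\<psi>\<^sub>0\<close> is.  For A5, the candidate
  for a common face is the face of \<open>C\<close> generated by \<open>\<psi>\<close>.\<close>

subsection \<open>Chebyshev centres and orthogonal projections\<close>

text \<open>By the parallelogram law the midpoint of two distinct centres admits a strictly smaller
  radius than they do. Nearly optimal centres are therefore close together, so a minimising sequence
  is Cauchy and the optimum is unique. For a singleton \<open>S\<close> the centre is the nearest
  point of \<open>V\<close>; for a bounded orbit of isometries it is a fixed point.\<close>

lemma closed_convex_center:
  fixes V S :: "'h::{real_inner,complete_space} set"
  assumes V: "closed V" "convex V" "V \<noteq> {}" and S: "bounded S" "S \<noteq> {}"
  obtains c r where "c \<in> V" "S \<subseteq> cball c r"
    "\<And>x \<rho>. x \<in> V \<Longrightarrow> S \<subseteq> cball x \<rho> \<Longrightarrow> r \<le> \<rho>"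
    "\<And>x. x \<in> V \<Longrightarrow> S \<subseteq> cball x r \<Longrightarrow> x = c"
proof -
  define R where "R = {\<rho>. \<exists>x\<in>V. S \<subseteq> cball x \<rho>}"
  define r where "r = Inf R"
  obtain s0 where s0: "s0 \<in> S" using S by blast
  obtain v0 where v0: "v0 \<in> V" using V by blast
  have R_ne: "R \<noteq> {}"
  proof -
    obtain e where "\<forall>y\<in>S. dist v0 y \<le> e" using S(1) bounded_any_center by blast
    then have "e \<in> R" unfolding R_def using v0 by (auto intro!: bexI[of _ v0])
    then show ?thesis by blast
  qed
  have R_nonneg: "0 \<le> \<rho>" if "\<rho> \<in> R" for \<rho>
    using that s0 unfolding R_def by (auto dest!: subsetD intro: order_trans[OF zero_le_dist])
  have bdd: "bdd_below R" using R_nonneg by (meson bdd_belowI)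
  have r_le: "r \<le> \<rho>" if "x \<in> V" "S \<subseteq> cball x \<rho>" for x \<rho>
    unfolding r_def using that by (intro cInf_lower bdd) (auto simp: R_def)
  have r_nonneg: "0 \<le> r" unfolding r_def using R_ne R_nonneg by (intro cInf_greatest) auto
  \<comment> \<open>All of \<open>S\<close> lies within \<open>sqrt q\<close> of the midpoint
    \<open>m\<close>; comparing with the least radius \<open>r\<close> bounds the distance of
    \<open>x\<close> and \<open>y\<close>. The case \<open>\<rho> = r\<close> gives uniqueness at
    the end.\<close>
  have key: "(norm (x - y))\<^sup>2 / 4 \<le> \<rho>\<^sup>2 - r\<^sup>2"
    if x: "x \<in> V" "S \<subseteq> cball x \<rho>" and y: "y \<in> V" "S \<subseteq> cball y \<rho>" for x y \<rho>
  proof -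
    define m where "m = (1/2) *\<^sub>R x + (1/2) *\<^sub>R y"
    define q where "q = \<rho>\<^sup>2 - (norm (x - y))\<^sup>2 / 4"
    have m: "m \<in> V" unfolding m_def using V(2) x y by (intro convexD) auto
    have d: "(norm (m - s))\<^sup>2 \<le> q" if "s \<in> S" for s
    proof -
      have "(norm (m - s))\<^sup>2 = (norm (x - s))\<^sup>2 / 2 + (norm (y - s))\<^sup>2 / 2 - (norm (x - y))\<^sup>2 / 4"
        unfolding m_def power2_norm_eq_inner
        by (simp add: inner_commute inner_add_left inner_add_right inner_diff_left inner_diff_right field_simps)
      moreover have "(norm (x - s))\<^sup>2 \<le> \<rho>\<^sup>2" "(norm (y - s))\<^sup>2 \<le> \<rho>\<^sup>2"
        using x(2) y(2) that by (auto simp: dist_norm intro!: power_mono)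
      ultimately show ?thesis unfolding q_def by simp
    qed
    \<comment> \<open>A point of \<open>S\<close> supplies \<open>0 \<le> q\<close>; for negative
      \<open>q\<close> the square of \<open>sqrt q\<close> would be \<open>- q\<close>.\<close>
    have q0: "0 \<le> q" using d[OF s0] by (meson order_trans zero_le_power2)
    have "S \<subseteq> cball m (sqrt q)" using d by (auto simp: dist_norm intro!: real_le_rsqrt)
    then have "r \<le> sqrt q" using m r_le by blast
    then have "r\<^sup>2 \<le> (sqrt q)\<^sup>2" using r_nonneg by (intro power_mono) auto
    then show ?thesis using q0 unfolding q_def by simp
  qed
  define e where "e n = 1 / real (Suc n)" for n
  have "\<exists>x\<in>V. S \<subseteq> cball x (r + e n)" for n
  proof -
    have "Inf R < r + e n" unfolding r_def e_def by simp
    then obtain \<rho> where "\<rho> \<in> R" "\<rho> < r + e n" using cInf_lessD[OF R_ne] by blast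
    then show ?thesis unfolding R_def by (auto intro!: bexI)
  qed
  then obtain x where x: "\<And>n. x n \<in> V" "\<And>n. S \<subseteq> cball (x n) (r + e n)" by metis
  have e_lim: "e \<longlonglongrightarrow> 0" unfolding e_def using lim_inverse_n' LIMSEQ_Suc by blast
  have e_pos: "0 < e n" for n by (simp add: e_def)
  have "Cauchy x"
  proof (rule metric_CauchyI)
    fix d :: real assume d: "0 < d"
    have "(\<lambda>n. (r + e n)\<^sup>2 - r\<^sup>2) \<longlonglongrightarrow> (r + 0)\<^sup>2 - r\<^sup>2" by (intro tendsto_intros e_lim)
    then have "\<forall>\<^sub>F n in sequentially. (r + e n)\<^sup>2 - r\<^sup>2 < d\<^sup>2 / 4"
      using d by (intro order_tendstoD(2)[where y = "(r + 0)\<^sup>2 - r\<^sup>2"]) auto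
    then obtain N where N: "(r + e N)\<^sup>2 - r\<^sup>2 < d\<^sup>2 / 4" by (auto simp: eventually_sequentially)
    have "dist (x m) (x n) < d" if "m \<ge> N" "n \<ge> N" for m n
    proof -
      have "e m \<le> e N" "e n \<le> e N" using that by (auto simp: e_def field_simps)
      then have "S \<subseteq> cball (x m) (r + e N)" "S \<subseteq> cball (x n) (r + e N)"
        using x(2)[of m] x(2)[of n] by fastforce+
      then have "(norm (x m - x n))\<^sup>2 / 4 \<le> (r + e N)\<^sup>2 - r\<^sup>2" using key x(1) by blast
      then have "(norm (x m - x n))\<^sup>2 < d\<^sup>2" using N by simp
      then show ?thesis using d by (simp add: dist_norm power_less_imp_less_base)
    qed
    then show "\<exists>M. \<forall>m\<ge>M. \<forall>n\<ge>M. dist (x m) (x n) < d" by blast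
  qed
  then obtain c where c: "x \<longlonglongrightarrow> c" using Cauchy_convergent_iff convergent_def by blast
  have cV: "c \<in> V" using c x(1) V(1) closed_sequentially by blast
  have cS: "S \<subseteq> cball c r"
  proof
    fix s assume s: "s \<in> S"
    have "(\<lambda>n. dist (x n) s) \<longlonglongrightarrow> dist c s" by (intro tendsto_intros c)
    moreover have "(\<lambda>n. r + e n) \<longlonglongrightarrow> r + 0" by (intro tendsto_intros e_lim)
    ultimately have "dist c s \<le> r + 0"
      using x(2) s by (intro LIMSEQ_le) fastforce+
    then show "s \<in> cball c r" by simp
  qed
  have "y = c" if "y \<in> V" "S \<subseteq> cball y r" for y
    using key[OF that cV cS] by simp
  with that cV cS r_le show ?thesis by blast
qed

text \<open>The nearest point of \<open>V\<close> to \<open>x\<close> is the centre of the singleton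
  \<open>{x}\<close>. It cannot be improved by moving along any \<open>z\<close> in
  \<open>V\<close>, and this forces orthogonality.\<close>

lemma orth_proj_exists:
  fixes V :: "'h::{real_inner,complete_space} set"
  assumes "closed V" "subspace V"
  shows "\<exists>y\<in>V. \<forall>z\<in>V. orthogonal (x - y) z"
proof -
  obtain y r where y: "y \<in> V" "{x} \<subseteq> cball y r"
    and r: "\<And>u \<rho>. u \<in> V \<Longrightarrow> {x} \<subseteq> cball u \<rho> \<Longrightarrow> r \<le> \<rho>"
    using closed_convex_center[of V "{x}"] assms subspace_imp_convex subspace_0 by (metis bounded_insert bounded_empty empty_iff insert_not_empty)
  have min: "norm (x - y) \<le> norm (x - u)" if "u \<in> V" for u
    using y(2) r[OF that, of "norm (x - u)"] by (auto simp: dist_norm norm_minus_commute)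
  have "(x - y) \<bullet> z = 0" if z: "z \<in> V" for z
  proof (cases "z = 0")
    case False
    \<comment> \<open>This \<open>t\<close> minimises the distance from \<open>x\<close> to the line
      through \<open>y\<close> in direction \<open>z\<close>; the squared distance drops by
      \<open>t * ((x - y) \<bullet> z)\<close>, which minimality of \<open>y\<close> makes
      non-positive.\<close>
    define t where "t = ((x - y) \<bullet> z) / (z \<bullet> z)"
    have zz: "z \<bullet> z > 0" using False by simp
    have "y + t *\<^sub>R z \<in> V" using assms y z by (simp add: subspace_add subspace_scale)
    then have "(norm (x - y))\<^sup>2 \<le> (norm (x - (y + t *\<^sub>R z)))\<^sup>2"
      using min by (intro power_mono) auto
    also have "\<dots> = (norm ((x - y) - t *\<^sub>R z))\<^sup>2" by (simp add: algebra_simps)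
    also have "\<dots> = (norm (x - y))\<^sup>2 - 2 * t * ((x - y) \<bullet> z) + t * (t * (z \<bullet> z))"
      unfolding power2_norm_eq_inner
      by (simp only: inner_diff_left[of _ "t *\<^sub>R z"] inner_diff_right[of _ "x - y"])
         (simp add: inner_commute algebra_simps)
    also have "t * (z \<bullet> z) = (x - y) \<bullet> z" unfolding t_def using zz by simp
    finally have "t * ((x - y) \<bullet> z) \<le> 0" by simp
    then have "((x - y) \<bullet> z) * ((x - y) \<bullet> z) / (z \<bullet> z) \<le> 0" by (simp add: t_def)
    then have "((x - y) \<bullet> z) * ((x - y) \<bullet> z) \<le> 0" using zz by (simp add: divide_le_0_iff)
    then show ?thesis using mult_eq_0_iff by (metis antisym zero_le_square)
  qed simp
  then show ?thesis using y(1) by (auto simp: orthogonal_def)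
qed

section \<open>Characterisation and properties of orthogonal projections\<close>

lemma orth_proj_unique:
  assumes "subspace V" "y \<in> V" "\<forall>z\<in>V. orthogonal (x - y) z" "y' \<in> V" "\<forall>z\<in>V. orthogonal (x - y') z"
  shows "y' = y"
proof -
  have "y - y' \<in> V" using assms by (simp add: subspace_diff)
  then have "(x - y') \<bullet> (y - y') = 0" "(x - y) \<bullet> (y - y') = 0" using assms by (auto simp: orthogonal_def)
  then have "(y - y') \<bullet> (y - y') = 0" by (simp add: inner_diff_left)
  then show ?thesis by simp
qed

lemma orth_proj_eqI:
  assumes "subspace V" "y \<in> V" "\<And>z. z \<in> V \<Longrightarrow> (x - y) \<bullet> z = 0"
  shows "orth_proj V x = y"
  unfolding orth_proj_def
proof (rule the_equality)
  show y: "y \<in> V \<and> (\<forall>z\<in>V. orthogonal (x - y) z)"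
    using assms by (simp add: orthogonal_def)
  show "y' = y" if "y' \<in> V \<and> (\<forall>z\<in>V. orthogonal (x - y') z)" for y'
    using orth_proj_unique[OF assms(1)] y that by blast
qed

context
  fixes V :: "'h::{real_inner,complete_space} set"
  assumes V: "closed V" "subspace V"
begin

lemma orth_proj_in: "orth_proj V x \<in> V"
  and orth_proj_orth: "z \<in> V \<Longrightarrow> (x - orth_proj V x) \<bullet> z = 0"
proof -
  obtain y where y: "y \<in> V" "\<forall>z\<in>V. orthogonal (x - y) z" using orth_proj_exists[OF V] by blast
  then have "orth_proj V x = y" using V by (intro orth_proj_eqI) (auto simp: orthogonal_def)
  then show "orth_proj V x \<in> V" "z \<in> V \<Longrightarrow> (x - orth_proj V x) \<bullet> z = 0"
    using y by (auto simp: orthogonal_def)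
qed

lemma orth_proj_ident: "x \<in> V \<Longrightarrow> orth_proj V x = x"
  using V by (intro orth_proj_eqI) auto

lemma linear_orth_proj: "linear (orth_proj V)"
proof (rule linearI)
  show "orth_proj V (x + y) = orth_proj V x + orth_proj V y" for x y
  proof (rule orth_proj_eqI)
    fix z assume "z \<in> V"
    then show "(x + y - (orth_proj V x + orth_proj V y)) \<bullet> z = 0"
      using orth_proj_orth[of z x] orth_proj_orth[of z y] by (simp add: inner_diff_left inner_add_left)
  qed (use V in \<open>auto intro: subspace_add orth_proj_in\<close>)
  show "orth_proj V (c *\<^sub>R x) = c *\<^sub>R orth_proj V x" for c x
  proof (rule orth_proj_eqI)
    fix z assume "z \<in> V"
    then show "(c *\<^sub>R x - c *\<^sub>R orth_proj V x) \<bullet> z = 0"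
      using orth_proj_orth[of z x] by (simp add: inner_diff_left)
  qed (use V in \<open>auto intro: subspace_scale orth_proj_in\<close>)
qed

lemma norm_orth_proj_le: "norm (orth_proj V x) \<le> norm x"
proof -
  have "orth_proj V x \<bullet> orth_proj V x = x \<bullet> orth_proj V x"
    using orth_proj_orth[OF orth_proj_in[of x], of x] by (simp add: inner_diff_left)
  then have "norm (orth_proj V x) * norm (orth_proj V x) \<le> norm x * norm (orth_proj V x)"
    using norm_cauchy_schwarz[of x "orth_proj V x"] by (simp add: dot_square_norm power2_eq_square)
  then show ?thesis by (cases "norm (orth_proj V x) = 0") auto
qed

lemma bounded_linear_orth_proj: "bounded_linear (orth_proj V)"
  using linear_orth_proj norm_orth_proj_le by (intro bounded_linear_intro[where K = 1]) (auto simp: linear_add linear_scale)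

lemma closed_proper_subspace_orth_witness:
  assumes "V \<noteq> UNIV"
  obtains u where "u \<noteq> 0" "\<And>z. z \<in> V \<Longrightarrow> u \<bullet> z = 0"
proof -
  obtain x where "x \<notin> V" using assms by blast
  then have "x - orth_proj V x \<noteq> 0" using orth_proj_in[of x] by auto
  with that orth_proj_orth show ?thesis by blast
qed

end

section \<open>Identities that only need checking on a total set\<close>

lemma total_inner_eqI:
  assumes "total_subset S" "\<And>y. y \<in> S \<Longrightarrow> x \<bullet> y = x' \<bullet> y"
  shows "x = x'"
proof -
  have "S \<subseteq> {y. (x - x') \<bullet> y = 0}" using assms(2) by (auto simp: inner_diff_left)
  then have "span S \<subseteq> {y. (x - x') \<bullet> y = 0}"
    by (rule span_minimal) (simp add: subspace_def inner_add_right)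
  then have "closure (span S) \<subseteq> {y. (x - x') \<bullet> y = 0}"
    by (rule closure_minimal) (intro closed_Collect_eq continuous_intros)
  then have "(x - x') \<bullet> (x - x') = 0" using assms(1) unfolding total_subset_def by blast
  then show ?thesis by simp
qed

lemma total_linear_eqI:
  assumes S: "total_subset S" and f: "bounded_linear f" and f': "bounded_linear f'"
    and eq: "\<And>y. y \<in> S \<Longrightarrow> f y = f' y"
  shows "f x = f' x"
proof -
  note lin = bounded_linear.linear[OF f] bounded_linear.linear[OF f']
  have "S \<subseteq> {y. f y = f' y}" using eq by blast
  then have "span S \<subseteq> {y. f y = f' y}"
    by (rule span_minimal) (simp add: subspace_def linear_0 linear_add linear_scale lin)
  then have "closure (span S) \<subseteq> {y. f y = f' y}"
    by (rule closure_minimal) (intro closed_Collect_eq linear_continuous_on f f')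
  then show ?thesis using S unfolding total_subset_def by blast
qed

subsection \<open>Operators from positive kernels\<close>

lemma subspace_closure:
  fixes S :: "'a::real_normed_vector set"
  assumes "subspace S"
  shows "subspace (closure S)"
proof (rule subspaceI)
  show "0 \<in> closure S" using subspace_0[OF assms] closure_subset by blast
  show "x + y \<in> closure S" if "x \<in> closure S" "y \<in> closure S" for x y
  proof -
    obtain u v where "\<forall>n. u n \<in> S" "u \<longlonglongrightarrow> x" "\<forall>n. v n \<in> S" "v \<longlonglongrightarrow> y"
      using \<open>x \<in> _\<close> \<open>y \<in> _\<close> by (auto simp: closure_sequential)
    then have "\<forall>n. u n + v n \<in> S" "(\<lambda>n. u n + v n) \<longlonglongrightarrow> x + y"
      using assms by (auto intro: subspace_add tendsto_add)
    then show ?thesis unfolding closure_sequential by metis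
  qed
  show "c *\<^sub>R x \<in> closure S" if "x \<in> closure S" for c x
  proof -
    obtain u where "\<forall>n. u n \<in> S" "u \<longlonglongrightarrow> x" using \<open>x \<in> _\<close> by (auto simp: closure_sequential)
    then have "\<forall>n. c *\<^sub>R u n \<in> S" "(\<lambda>n. c *\<^sub>R u n) \<longlonglongrightarrow> c *\<^sub>R x"
      using assms by (auto intro: subspace_scale tendsto_intros)
    then show ?thesis unfolding closure_sequential by metis
  qed
qed

text \<open>Indices may repeat: the sums run over finite sequences, as in
  \<open>cond_neg_type\<close>, so that kernel inequalities apply to them directly.\<close>

lemma span_range_combination:
  fixes f :: "'i \<Rightarrow> 'a::real_vector"
  assumes "z \<in> span (range f)"
  obtains n l i where "z = (\<Sum>k<(n::nat). l k *\<^sub>R f (i k))"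
proof -
  have "\<exists>n l i. z = (\<Sum>k<(n::nat). l k *\<^sub>R f (i k))"
    using assms
  proof (induction rule: span_induct_alt)
    case base
    show ?case by (rule exI[of _ 0]) simp
  next
    case (step c x y)
    then obtain n l i j where *: "x = f j" "y = (\<Sum>k<(n::nat). l k *\<^sub>R f (i k))" by auto
    have "c *\<^sub>R x + y = (\<Sum>k<Suc n. (l(n := c)) k *\<^sub>R f ((i(n := j)) k))"
      using * by simp
    then show ?case by blast
  qed
  with that show ?thesis by blast
qed

text \<open>Admitting \<open>p = 0\<close> yields Cauchy-Schwarz for forms that are merely
  semidefinite. In that case a non-zero \<open>q\<close> would give the value \<open>-1\<close> at
  the chosen argument; for positive \<open>p\<close> the vertex is inserted.\<close>

lemma quadratic_nonneg_imp_discriminant: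
  fixes p q r :: real
  assumes "\<And>t. 0 \<le> p * t\<^sup>2 + 2 * q * t + r" and "0 \<le> p"
  shows "q\<^sup>2 \<le> p * r"
proof (cases "p = 0")
  case True
  show ?thesis
  proof (cases "q = 0")
    case False
    then have "2 * q * (- (r + 1) / (2 * q)) = - (r + 1)" by simp
    with assms(1)[of "- (r + 1) / (2 * q)"] True show ?thesis by simp
  qed (simp add: True)
next
  case False
  then have p: "p > 0" using assms by simp
  have "0 \<le> p * (p * (- q / p)\<^sup>2 + 2 * q * (- q / p) + r)"
    using assms(1)[of "- q / p"] p by (intro mult_nonneg_nonneg) simp_all
  also have "\<dots> = p * r - q\<^sup>2" using p by (simp add: power2_eq_square field_simps)
  finally show ?thesis by simp
qed

text \<open>The vector \<open>a\<close> is read off from the component of \<open>(0, 1)\<close> orthogonal to the closed graph.\<close>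

lemma riesz_family:
  fixes f :: "'i \<Rightarrow> 'h::{real_inner,complete_space}" and \<phi> :: "'i \<Rightarrow> real"
  assumes bound: "\<And>z. z \<in> span (range (\<lambda>i. (f i, \<phi> i))) \<Longrightarrow> \<bar>snd z\<bar> \<le> C * norm (fst z)"
  obtains a where "\<And>i. a \<bullet> f i = \<phi> i"
proof -
  define R where "R = closure (span (range (\<lambda>i. (f i, \<phi> i))))"
  have R: "closed R" "subspace R" unfolding R_def by (auto intro: closed_closure subspace_closure)
  have "closed {z. \<bar>snd z\<bar> \<le> C * norm (fst z :: 'h)}"
    by (intro closed_Collect_le continuous_intros)
  then have "R \<subseteq> {z. \<bar>snd z\<bar> \<le> C * norm (fst z)}"
    unfolding R_def using bound by (intro closure_minimal) blast
  then have bR: "\<bar>snd z\<bar> \<le> C * norm (fst z)" if "z \<in> R" for z using that by blast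
  obtain y where y: "y \<in> R" "\<forall>z\<in>R. orthogonal ((0, 1) - y) z"
    using orth_proj_exists[OF R] by blast
  define u s where "u = fst ((0, 1) - y)" and "s = snd ((0, 1) - y)"
  have y_eq: "y = (- u, 1 - s)" unfolding u_def s_def by (simp add: prod_eq_iff)
  have orth: "u \<bullet> fst z + s * snd z = 0" if "z \<in> R" for z
    using y(2) that by (auto simp: orthogonal_def u_def s_def inner_prod_def)
  \<comment> \<open>If \<open>s = 0\<close> then \<open>y = (- u, 1)\<close>, and orthogonality to
    \<open>y\<close> itself gives \<open>u = 0\<close>; but \<open>(0, 1)\<close> violates the bound
    that holds on \<open>R\<close>.\<close>
  have s: "s \<noteq> 0"
  proof
    assume "s = 0"
    with orth[OF y(1)] have "u = 0" by (simp add: y_eq)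
    with bR[OF y(1)] \<open>s = 0\<close> show False by (simp add: y_eq)
  qed
  have "(- (1 / s) *\<^sub>R u) \<bullet> f i = \<phi> i" for i
  proof -
    have "(f i, \<phi> i) \<in> R" unfolding R_def by (meson closure_subset rangeI span_base subsetD)
    from orth[OF this] have "u \<bullet> f i = - (s * \<phi> i)" by simp
    then show ?thesis using s by simp
  qed
  then show ?thesis by (rule that)
qed

text \<open>The bound survives in the closure and makes it single-valued; density of the domain and
  completeness of the target give every \<open>x\<close> a value. Since the graph lies in
  \<open>closure R\<close>, every closed condition on \<open>R\<close> is inherited by
  \<open>A\<close>.\<close>

lemma graph_operator:
  fixes R :: "('a::real_normed_vector \<times> 'b::{real_normed_vector,complete_space}) set"
  assumes R: "subspace R" and bound: "\<And>z. z \<in> R \<Longrightarrow> norm (snd z) \<le> C * norm (fst z)"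
    and dense: "closure (fst ` R) = UNIV"
  obtains A where "linear A" "\<And>x. (x, A x) \<in> closure R" "\<And>z. z \<in> R \<Longrightarrow> A (fst z) = snd z"
proof -
  define G where "G = closure R"
  have G: "subspace G" unfolding G_def using R by (rule subspace_closure)
  have "closed {z. norm (snd z :: 'b) \<le> C * norm (fst z :: 'a)}"
    by (intro closed_Collect_le continuous_intros)
  then have "G \<subseteq> {z. norm (snd z) \<le> C * norm (fst z)}"
    unfolding G_def using bound by (intro closure_minimal) blast
  then have bG: "norm (snd z) \<le> C * norm (fst z)" if "z \<in> G" for z using that by blast
  have uniq: "y = y'" if "(x, y) \<in> G" "(x, y') \<in> G" for x y y'
    using bG[OF subspace_diff[OF G that]] by simp
  have "\<exists>y. (x, y) \<in> G" for x
  proof -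
    have "x \<in> closure (fst ` R)" using dense by simp
    then obtain u where u: "\<And>n. u n \<in> fst ` R" "u \<longlonglongrightarrow> x" by (auto simp: closure_sequential)
    have "\<forall>n. \<exists>w. w \<in> R \<and> fst w = u n" using u(1) by (metis imageE)
    then obtain z where "\<forall>n. z n \<in> R \<and> fst (z n) = u n" by (elim choice[THEN exE])
    then have z: "z n \<in> R" "fst (z n) = u n" for n by simp_all
    have "Cauchy (\<lambda>n. snd (z n))"
    proof (rule metric_CauchyI)
      fix e :: real assume e: "0 < e"
      \<comment> \<open>\<open>C\<close> may be zero or negative, so it is replaced by a positive
        constant by which \<open>e\<close> can be divided.\<close>
      define K where "K = \<bar>C\<bar> + 1"
      have K: "K > 0" "C \<le> K" unfolding K_def by auto
      have "Cauchy u" using u(2) LIMSEQ_imp_Cauchy by blast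
      then obtain M where M: "\<forall>m\<ge>M. \<forall>n\<ge>M. dist (u m) (u n) < e / K"
        using e K unfolding Cauchy_def by (meson divide_pos_pos)
      have "dist (snd (z m)) (snd (z n)) < e" if "m \<ge> M" "n \<ge> M" for m n
      proof -
        have "dist (snd (z m)) (snd (z n)) \<le> C * dist (u m) (u n)"
          using bound[OF subspace_diff[OF R z(1)[of m] z(1)[of n]]] z(2) by (simp add: dist_norm)
        also have "\<dots> \<le> K * dist (u m) (u n)" using K by (intro mult_right_mono) auto
        also have "\<dots> < e" using M that K by (simp add: field_simps)
        finally show ?thesis .
      qed
      then show "\<exists>M. \<forall>m\<ge>M. \<forall>n\<ge>M. dist (snd (z m)) (snd (z n)) < e" by blast
    qed
    then obtain y where "(\<lambda>n. snd (z n)) \<longlonglongrightarrow> y" using Cauchy_convergent_iff convergent_def by blast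
    then have "(\<lambda>n. (u n, snd (z n))) \<longlonglongrightarrow> (x, y)" using u(2) by (intro tendsto_Pair)
    moreover have "\<forall>n. (u n, snd (z n)) \<in> R" using z by (metis prod.collapse)
    ultimately have "(x, y) \<in> G" unfolding G_def closure_sequential
      by (intro exI[of _ "\<lambda>n. (u n, snd (z n))"] conjI)
    then show ?thesis by blast
  qed
  then obtain A where A: "\<And>x. (x, A x) \<in> G" by metis
  have "linear A"
  proof (rule linearI)
    show "A (x + y) = A x + A y" for x y
      using uniq A[of "x + y"] subspace_add[OF G A[of x] A[of y]] by simp
    show "A (c *\<^sub>R x) = c *\<^sub>R A x" for c x
      using uniq A[of "c *\<^sub>R x"] subspace_scale[OF G A[of x], of c] by simp
  qed
  moreover have "A (fst z) = snd z" if "z \<in> R" for z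
    using uniq[OF A[of "fst z"], of "snd z"] that closure_subset[of R] unfolding G_def by auto
  ultimately show ?thesis using that A unfolding G_def by blast
qed

text \<open>Cauchy-Schwarz for \<open>K\<close> bounds the functional
  \<open>f j \<mapsto> K i j\<close>, so it is represented by a vector \<open>a i\<close>, the
  intended value of \<open>A\<close> at \<open>f i\<close>. The linear relation \<open>R\<close>
  spanned by the pairs \<open>(f i, a i)\<close> is symmetric, positive and contractive, and extends
  by density.\<close>

lemma positive_kernel_operator:
  fixes K :: "'i \<Rightarrow> 'i \<Rightarrow> real" and f :: "'i \<Rightarrow> 'h::{real_inner,complete_space}"
  assumes sym: "\<And>i j. K i j = K j i"
    and pos: "\<And>n l i. 0 \<le> (\<Sum>k<(n::nat). \<Sum>m<n. l k * l m * K (i k) (i m))"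
    and le: "\<And>n l i. (\<Sum>k<(n::nat). \<Sum>m<n. l k * l m * K (i k) (i m)) \<le> (norm (\<Sum>k<n. l k *\<^sub>R f (i k)))\<^sup>2"
    and total: "closure (span (range f)) = UNIV"
  obtains A where "linear A" "\<And>x y. A x \<bullet> y = x \<bullet> A y" "\<And>x. 0 \<le> A x \<bullet> x"
    "\<And>x. A x \<bullet> x \<le> (norm x)\<^sup>2" "\<And>i j. A (f i) \<bullet> f j = K i j"
proof -
  have "\<exists>a. \<forall>j. a \<bullet> f j = K i j" for i
  proof -
    have "\<bar>snd z\<bar> \<le> sqrt (K i i) * norm (fst z)"
      if "z \<in> span (range (\<lambda>j. (f j, K i j)))" for z
    proof -
      obtain n l h where z: "z = (\<Sum>k<(n::nat). l k *\<^sub>R (f (h k), K i (h k)))"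
        using span_range_combination[OF \<open>z \<in> _\<close>] .
      define q where "q = (\<Sum>k<n. l k * K i (h k))"
      define Q where "Q = (\<Sum>k<n. \<Sum>m<n. l k * l m * K (h k) (h m))"
      have z2: "snd z = q" "fst z = (\<Sum>k<n. l k *\<^sub>R f (h k))"
        unfolding z q_def by (simp_all add: snd_sum fst_sum)
      have Kii: "0 \<le> K i i" using pos[where n = 1 and l = "\<lambda>_. 1" and i = "\<lambda>_. i"] by simp
      \<comment> \<open>Positivity of the kernel is applied to the given family with the index
        \<open>i\<close> appended with weight \<open>t\<close>.\<close>
      have "0 \<le> K i i * t\<^sup>2 + 2 * q * t + Q" for t
      proof -
        let ?l = "l(n := t)" and ?h = "h(n := i)"
        have "(\<Sum>k<Suc n. \<Sum>m<Suc n. ?l k * ?l m * K (?h k) (?h m)) =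
          Q + (\<Sum>k<n. l k * t * K (h k) i) + ((\<Sum>m<n. t * l m * K i (h m)) + t * t * K i i)"
          by (simp add: sum.distrib Q_def)
        also have "\<dots> = K i i * t\<^sup>2 + 2 * q * t + Q"
        proof -
          have "(\<Sum>k<n. l k * t * K (h k) i) = t * q" "(\<Sum>m<n. t * l m * K i (h m)) = t * q"
            unfolding q_def sum_distrib_left by (intro sum.cong refl; simp add: sym[of "h _" i])+
          then show ?thesis by (simp add: power2_eq_square)
        qed
        finally show ?thesis using pos[where n = "Suc n" and l = ?l and i = ?h] by simp
      qed
      then have "q\<^sup>2 \<le> K i i * Q" using Kii by (rule quadratic_nonneg_imp_discriminant)
      also have "\<dots> \<le> K i i * (norm (fst z))\<^sup>2"
        unfolding Q_def z2(2) using le Kii by (intro mult_left_mono)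
      finally have "sqrt (q\<^sup>2) \<le> sqrt (K i i * (norm (fst z))\<^sup>2)" by (rule real_sqrt_le_mono)
      then show ?thesis by (simp add: z2 real_sqrt_mult)
    qed
    then show ?thesis
      by (rule riesz_family[of f "K i" "sqrt (K i i)"]) (assumption | rule exI allI)+
  qed
  then have "\<forall>i. \<exists>a. \<forall>j. a \<bullet> f j = K i j" by blast
  then obtain a where "\<forall>i j. a i \<bullet> f j = K i j" by (elim choice[THEN exE])
  then have a: "a i \<bullet> f j = K i j" for i j by blast
  define R where "R = span (range (\<lambda>i. (f i, a i)))"
  have R: "subspace R" by (simp add: R_def)
  have gen: "(f i, a i) \<in> R" for i unfolding R_def by (auto intro: span_base)
  have sym_a: "a i \<bullet> f j = f i \<bullet> a j" for i j
    using a[of i j] a[of j i] sym[of i j] by (simp add: inner_commute)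
  have symR: "snd z \<bullet> fst w = fst z \<bullet> snd w" if "z \<in> R" "w \<in> R" for z w
  proof -
    have one: "snd z \<bullet> f j = fst z \<bullet> a j" if "z \<in> R" for z j
      using that unfolding R_def
      by (induction rule: span_induct_alt)
         (auto simp: inner_add_left sym_a)
    show ?thesis
      using \<open>w \<in> R\<close> unfolding R_def
      by (induction rule: span_induct_alt) (auto simp: inner_add_right one[OF \<open>z \<in> R\<close>])
  qed
  have posR: "0 \<le> snd z \<bullet> fst z" "snd z \<bullet> fst z \<le> (norm (fst z))\<^sup>2" if zR: "z \<in> R" for z
  proof -
    obtain n l h where z: "z = (\<Sum>k<(n::nat). l k *\<^sub>R (f (h k), a (h k)))"
      using span_range_combination zR unfolding R_def by blast
    have z2: "snd z = (\<Sum>k<n. l k *\<^sub>R a (h k))" "fst z = (\<Sum>k<n. l k *\<^sub>R f (h k))"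
      unfolding z by (simp_all add: snd_sum fst_sum)
    have "snd z \<bullet> fst z = (\<Sum>k<n. l k * (a (h k) \<bullet> (\<Sum>m<n. l m *\<^sub>R f (h m))))"
      unfolding z2 by (simp add: inner_sum_left)
    also have "\<dots> = (\<Sum>k<n. \<Sum>m<n. l k * l m * K (h k) (h m))"
      by (simp add: inner_sum_right a sum_distrib_left mult.assoc)
    finally have "snd z \<bullet> fst z = (\<Sum>k<n. \<Sum>m<n. l k * l m * K (h k) (h m))" .
    then show "0 \<le> snd z \<bullet> fst z" "snd z \<bullet> fst z \<le> (norm (fst z))\<^sup>2"
      unfolding z2(2) using pos le by simp_all
  qed
  \<comment> \<open>Cauchy-Schwarz for the semidefinite form \<open>snd z \<bullet> fst w\<close> on
    \<open>R\<close>, with both diagonal values estimated by \<open>posR\<close>.\<close>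
  have csR: "(snd z \<bullet> fst w)\<^sup>2 \<le> (norm (fst z))\<^sup>2 * (norm (fst w))\<^sup>2" if "z \<in> R" "w \<in> R" for z w
  proof -
    have "0 \<le> (snd z \<bullet> fst z) * t\<^sup>2 + 2 * (snd z \<bullet> fst w) * t + snd w \<bullet> fst w" for t
    proof -
      have "t *\<^sub>R z + w \<in> R" using that R by (simp add: subspace_add subspace_scale)
      from posR(1)[OF this] show ?thesis
        using symR[OF that]
        by (simp add: inner_add_left inner_add_right power2_eq_square algebra_simps inner_commute)
    qed
    then have "(snd z \<bullet> fst w)\<^sup>2 \<le> (snd z \<bullet> fst z) * (snd w \<bullet> fst w)"
      using posR(1)[OF that(1)] by (rule quadratic_nonneg_imp_discriminant)
    also have "\<dots> \<le> (norm (fst z))\<^sup>2 * (norm (fst w))\<^sup>2"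
      using posR that by (intro mult_mono) auto
    finally show ?thesis .
  qed
  have fstR: "fst ` R = span (range f)"
    unfolding R_def by (subst linear_span_image[symmetric]) (auto simp: image_image linear_fst)
  \<comment> \<open>The estimate against first components of \<open>R\<close> passes to their
    closure, which is the whole space; then \<open>x = snd z\<close> may be inserted and one factor
    cancelled.\<close>
  have bound: "norm (snd z) \<le> 1 * norm (fst z)" if "z \<in> R" for z
  proof -
    have "closed {x. snd z \<bullet> x \<le> norm (fst z) * norm x}"
      by (intro closed_Collect_le continuous_intros)
    moreover have "snd z \<bullet> x \<le> norm (fst z) * norm x" if "x \<in> span (range f)" for x
    proof -
      obtain w where w: "w \<in> R" "x = fst w" using \<open>x \<in> _\<close> fstR by blast
      have "(snd z \<bullet> x)\<^sup>2 \<le> (norm (fst z) * norm x)\<^sup>2"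
        using csR[OF \<open>z \<in> R\<close> w(1)] w(2) by (simp add: power_mult_distrib)
      then show ?thesis by (rule power2_le_imp_le) simp
    qed
    ultimately have "closure (span (range f)) \<subseteq> {x. snd z \<bullet> x \<le> norm (fst z) * norm x}"
      by (intro closure_minimal) auto
    then have "snd z \<bullet> snd z \<le> norm (fst z) * norm (snd z)" using total by auto
    then have "norm (snd z) * norm (snd z) \<le> norm (fst z) * norm (snd z)"
      by (simp add: dot_square_norm power2_eq_square)
    then show ?thesis by (cases "norm (snd z) = 0") auto
  qed
  obtain A where A: "linear A" "\<And>x. (x, A x) \<in> closure R" "\<And>z. z \<in> R \<Longrightarrow> A (fst z) = snd z"
  proof (rule graph_operator[OF R bound])
    show "closure (fst ` R) = UNIV" using fstR total by simp
  qed (assumption | rule that)+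
  \<comment> \<open>Positivity and the upper bound are closed conditions on pairs, hence pass to the
    graph of \<open>A\<close>. Symmetry follows below in the same way, one argument at a
    time.\<close>
  have "0 \<le> A x \<bullet> x \<and> A x \<bullet> x \<le> (norm x)\<^sup>2" for x
  proof -
    have "closed {z :: 'h \<times> 'h. 0 \<le> snd z \<bullet> fst z \<and> snd z \<bullet> fst z \<le> (norm (fst z))\<^sup>2}"
      by (intro closed_Collect_conj closed_Collect_le continuous_intros)
    then have "closure R \<subseteq> {z. 0 \<le> snd z \<bullet> fst z \<and> snd z \<bullet> fst z \<le> (norm (fst z))\<^sup>2}"
      using posR by (intro closure_minimal) auto
    with A(2)[of x] show ?thesis by auto
  qed
  then have A_pos: "0 \<le> A x \<bullet> x" "A x \<bullet> x \<le> (norm x)\<^sup>2" for x by simp_all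
  have A_sym: "A x \<bullet> y = x \<bullet> A y" for x y
  proof -
    have "snd z \<bullet> y = fst z \<bullet> A y" if "z \<in> R" for z
    proof -
      have "closure R \<subseteq> {w. snd z \<bullet> fst w = fst z \<bullet> snd w}"
        using symR[OF that] by (intro closure_minimal closed_Collect_eq continuous_intros) auto
      with A(2)[of y] show ?thesis by auto
    qed
    then have "closure R \<subseteq> {z. snd z \<bullet> y = fst z \<bullet> A y}"
      by (intro closure_minimal closed_Collect_eq continuous_intros) blast
    with A(2)[of x] show ?thesis by auto
  qed
  have "A (f i) \<bullet> f j = K i j" for i j using A(3)[OF gen[of i]] a by simp
  with A(1) A_sym A_pos show ?thesis by (rule that)
qed

subsection \<open>Square roots and spectral subspaces\<close>

context
  fixes A :: "'h::{real_inner,complete_space} \<Rightarrow> 'h"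
  assumes A: "linear A" "\<And>x y. A x \<bullet> y = x \<bullet> A y" "\<And>x. 0 \<le> A x \<bullet> x"
    "\<And>x. A x \<bullet> x \<le> (norm x)\<^sup>2"
begin

text \<open>This is the operator inequality that the square of \<open>A\<close> is at most
  \<open>A\<close>: Cauchy-Schwarz for the form \<open>A x \<bullet> y\<close> at \<open>x\<close>
  and \<open>A x\<close>, after which \<open>A \<le> 1\<close> is used and a factor
  \<open>A x \<bullet> A x\<close> cancels.\<close>

lemma positive_contraction_norm_sq_le: "(norm (A x))\<^sup>2 \<le> A x \<bullet> x"
proof -
  have "0 \<le> (A x \<bullet> x) * t\<^sup>2 + 2 * (A x \<bullet> A x) * t + A (A x) \<bullet> A x" for t
    using A(3)[of "t *\<^sub>R x + A x"]
    by (simp add: linear_add[OF A(1)] linear_scale[OF A(1)] inner_add_left inner_add_right A(2)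
        power2_eq_square algebra_simps)
  then have "(A x \<bullet> A x)\<^sup>2 \<le> (A x \<bullet> x) * (A (A x) \<bullet> A x)"
    using A(3) by (rule quadratic_nonneg_imp_discriminant)
  also have "\<dots> \<le> (A x \<bullet> x) * (A x \<bullet> A x)"
    using A(3) A(4)[of "A x"] by (intro mult_left_mono) (auto simp: dot_square_norm)
  finally have "(A x \<bullet> A x) * (A x \<bullet> A x) \<le> (A x \<bullet> x) * (A x \<bullet> A x)"
    by (simp add: power2_eq_square)
  then have "A x \<bullet> A x \<le> A x \<bullet> x" using A(3)[of x] by (cases "A x = 0") auto
  then show ?thesis by (simp add: dot_square_norm)
qed

lemma positive_contraction_norm_le: "norm (A x) \<le> norm x"
  using positive_contraction_norm_sq_le[of x] A(4)[of x]
  by (intro power2_le_imp_le[of "norm (A x)"]) (linarith, simp)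

lemma positive_contraction_bounded_linear: "bounded_linear A"
  using A(1) positive_contraction_norm_le
  by (intro bounded_linear_intro[where K = 1]) (auto simp: linear_add linear_scale)

end

text \<open>The fixed point equation \<open>Y = (D + Y\<^sup>2) / 2\<close> says \<open>(1 - Y)\<^sup>2 = 1 - D\<close>.  For a contraction
  \<open>D\<close> the increments of the iteration are dominated by those of the scalar case \<open>D = 1\<close>.\<close>

primrec sqrt_iter :: "('a \<Rightarrow> 'a) \<Rightarrow> nat \<Rightarrow> 'a \<Rightarrow> 'a::real_vector" where
  "sqrt_iter D 0 = (\<lambda>x. 0)"
| "sqrt_iter D (Suc n) = (\<lambda>x. (1/2) *\<^sub>R (D x + sqrt_iter D n (sqrt_iter D n x)))"

primrec sqrt_bound :: "nat \<Rightarrow> real" where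
  "sqrt_bound 0 = 0"
| "sqrt_bound (Suc n) = (1 + (sqrt_bound n)\<^sup>2) / 2"

lemma sqrt_bound_range: "0 \<le> sqrt_bound n \<and> sqrt_bound n \<le> 1"
  by (induction n) (auto simp: power_le_one)

lemma sqrt_bound_mono: "sqrt_bound n \<le> sqrt_bound (Suc n)"
proof -
  have "0 \<le> (sqrt_bound n - 1)\<^sup>2" by simp
  then show ?thesis by (simp add: power2_eq_square algebra_simps)
qed

lemma Cauchy_sqrt_bound: "Cauchy sqrt_bound"
  using sqrt_bound_range sqrt_bound_mono
  by (intro convergent_Cauchy Bseq_mono_convergent BseqI'[where K = 1])
     (auto simp: incseq_Suc_iff intro: lift_Suc_mono_le)

context
  fixes D :: "'h::{real_inner,complete_space} \<Rightarrow> 'h"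
  assumes D: "linear D" "\<And>x. norm (D x) \<le> norm x"
begin

lemma linear_sqrt_iter: "linear (sqrt_iter D n)"
proof (induction n)
  case (Suc n)
  then show ?case
    by (auto intro!: linearI simp: linear_add[OF D(1)] linear_add[OF Suc]
        linear_scale[OF D(1)] linear_scale[OF Suc] algebra_simps)
qed (simp add: linear_zero)

lemma norm_sqrt_iter_le: "norm (sqrt_iter D n x) \<le> sqrt_bound n * norm x"
proof (induction n arbitrary: x)
  case (Suc n)
  have "norm (sqrt_iter D n (sqrt_iter D n x)) \<le> sqrt_bound n * (sqrt_bound n * norm x)"
    using Suc[of x] Suc[of "sqrt_iter D n x"] sqrt_bound_range[of n]
    by (meson mult_left_mono order_trans)
  then have "norm (D x + sqrt_iter D n (sqrt_iter D n x)) \<le> norm x + sqrt_bound n * (sqrt_bound n * norm x)"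
    using D(2)[of x] by (intro norm_triangle_le) linarith
  then have "norm (D x + sqrt_iter D n (sqrt_iter D n x)) / 2 \<le> (norm x + sqrt_bound n * (sqrt_bound n * norm x)) / 2"
    by simp
  moreover have "norm (sqrt_iter D (Suc n) x) = norm (D x + sqrt_iter D n (sqrt_iter D n x)) / 2"
    by (simp del: scaleR_add_right)
  ultimately show ?case by (simp add: power2_eq_square algebra_simps)
qed simp

text \<open>The iterates are polynomials in \<open>D\<close>. Taking first \<open>D\<close> and then
  an iterate for \<open>L\<close> shows that the iterates commute with one another.\<close>

lemma sqrt_iter_commute:
  assumes "linear L" "\<And>x. L (D x) = D (L x)"
  shows "L (sqrt_iter D n x) = sqrt_iter D n (L x)"
  by (induction n arbitrary: x)
     (simp_all add: linear_0[OF assms(1)] linear_add[OF assms(1)] linear_scale[OF assms(1)] assms(2)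
        del: scaleR_add_right)

text \<open>Because the iterates commute, the difference of the squares of two successive ones
  factors as their sum times their difference, and the norm bounds of the factors multiply exactly
  as in the scalar recursion.\<close>

lemma norm_sqrt_iter_Suc_diff_le:
  "norm (sqrt_iter D (Suc n) x - sqrt_iter D n x) \<le> (sqrt_bound (Suc n) - sqrt_bound n) * norm x"
proof (induction n arbitrary: x)
  case 0
  then show ?case using D(2)[of x] by simp
next
  case (Suc n)
  let ?Y = "sqrt_iter D" and ?y = sqrt_bound
  define d where "d = ?Y (Suc n) x - ?Y n x"
  note lin = linear_sqrt_iter
  have DY: "D (?Y m z) = ?Y m (D z)" for m z using sqrt_iter_commute[OF D(1)] by simp
  have comm: "?Y (Suc n) (?Y n x) = ?Y n (?Y (Suc n) x)"
    using sqrt_iter_commute[OF lin[of "Suc n"] DY[symmetric], of n x] .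
  have "?Y (Suc (Suc n)) x - ?Y (Suc n) x
      = (1/2) *\<^sub>R (?Y (Suc n) (?Y (Suc n) x) - ?Y n (?Y n x))"
  proof -
    have "(1/2) *\<^sub>R (p + q) - (1/2) *\<^sub>R (p + r) = (1/2) *\<^sub>R (q - r)" for p q r :: 'h
      by (simp add: algebra_simps)
    then show ?thesis by (simp only: sqrt_iter.simps)
  qed
  also have "?Y (Suc n) (?Y (Suc n) x) - ?Y n (?Y n x) = ?Y (Suc n) d + ?Y n d"
    unfolding d_def by (simp only: linear_diff[OF lin] comm) (simp only: algebra_simps)
  finally have "norm (?Y (Suc (Suc n)) x - ?Y (Suc n) x) = norm (?Y (Suc n) d + ?Y n d) / 2"
    by simp
  also have "\<dots> \<le> (?y (Suc n) * norm d + ?y n * norm d) / 2"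
    using norm_sqrt_iter_le[of "Suc n" d] norm_sqrt_iter_le[of n d]
    by (intro divide_right_mono norm_triangle_le) linarith+
  also have "\<dots> = (?y (Suc n) + ?y n) / 2 * norm d" by (simp only: distrib_right times_divide_eq_left)
  also have "\<dots> \<le> (?y (Suc n) + ?y n) / 2 * ((?y (Suc n) - ?y n) * norm x)"
    unfolding d_def using Suc[of x] sqrt_bound_range[of n] sqrt_bound_range[of "Suc n"]
    by (intro mult_left_mono) auto
  also have "\<dots> = ((?y (Suc n))\<^sup>2 - (?y n)\<^sup>2) / 2 * norm x"
  proof -
    have "(p + q) / 2 * ((p - q) * r) = (p\<^sup>2 - q\<^sup>2) / 2 * r" for p q r :: real
      by (simp add: power2_eq_square field_simps)
    then show ?thesis .
  qed
  also have "((?y (Suc n))\<^sup>2 - (?y n)\<^sup>2) / 2 = ?y (Suc (Suc n)) - ?y (Suc n)"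
    using sqrt_bound.simps(2)[of "Suc n"] sqrt_bound.simps(2)[of n] by argo
  finally show ?case .
qed

lemma norm_sqrt_iter_diff_le:
  "m \<le> n \<Longrightarrow> norm (sqrt_iter D n x - sqrt_iter D m x) \<le> (sqrt_bound n - sqrt_bound m) * norm x"
proof (induction n rule: dec_induct)
  case (step n)
  have "norm (sqrt_iter D (Suc n) x - sqrt_iter D m x) \<le>
    norm (sqrt_iter D (Suc n) x - sqrt_iter D n x) + norm (sqrt_iter D n x - sqrt_iter D m x)"
    using norm_triangle_ineq[of "sqrt_iter D (Suc n) x - sqrt_iter D n x" "sqrt_iter D n x - sqrt_iter D m x"]
    by (simp only: add_diff_eq diff_add_cancel)
  also have "\<dots> \<le> (sqrt_bound (Suc n) - sqrt_bound n) * norm x + (sqrt_bound n - sqrt_bound m) * norm x"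
    using step.IH norm_sqrt_iter_Suc_diff_le[of n x] by linarith
  finally show ?case by (simp only: algebra_simps)
qed simp

lemma Cauchy_sqrt_iter: "Cauchy (\<lambda>n. sqrt_iter D n x)"
proof (rule metric_CauchyI)
  fix e :: real assume "0 < e"
  then have "0 < e / (norm x + 1)" by (simp add: add_nonneg_pos)
  then obtain M where M: "\<forall>m\<ge>M. \<forall>n\<ge>M. dist (sqrt_bound m) (sqrt_bound n) < e / (norm x + 1)"
    using Cauchy_sqrt_bound unfolding Cauchy_def by blast
  have *: "dist (sqrt_iter D n x) (sqrt_iter D m x) < e" if "m \<le> n" "m \<ge> M" for m n
  proof -
    have "n \<ge> M" using that by simp
    then have "sqrt_bound n - sqrt_bound m < e / (norm x + 1)"
      using M[rule_format, of n m] that(2) by (auto simp: dist_real_def)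
    then have "(sqrt_bound n - sqrt_bound m) * (norm x + 1) < e"
      by (simp add: pos_less_divide_eq add_nonneg_pos)
    moreover have "0 \<le> sqrt_bound n - sqrt_bound m"
      using lift_Suc_mono_le[of sqrt_bound, OF sqrt_bound_mono that(1)] by simp
    ultimately show ?thesis
      using norm_sqrt_iter_diff_le[OF that(1), of x] by (simp add: dist_norm algebra_simps)
  qed
  have "dist (sqrt_iter D m x) (sqrt_iter D n x) < e" if "m \<ge> M" "n \<ge> M" for m n
    using *[of m n] *[of n m] that by (cases "m \<le> n") (auto simp: dist_commute)
  then show "\<exists>M. \<forall>m\<ge>M. \<forall>n\<ge>M. dist (sqrt_iter D m x) (sqrt_iter D n x) < e" by blast
qed

text \<open>\<open>S = 1 - Y\<close> for the pointwise limit \<open>Y\<close> of the iterates: the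
  recursion passes to the fixed point equation, positivity holds because \<open>Y\<close> is a
  contraction, and commutation survives the limit.\<close>

lemma sqrt_one_minus_contraction:
  obtains S where "bounded_linear S" "\<And>x. S (S x) = x - D x" "\<And>x. 0 \<le> S x \<bullet> x"
    "\<And>L x. bounded_linear L \<Longrightarrow> (\<And>x. L (D x) = D (L x)) \<Longrightarrow> L (S x) = S (L x)"
proof -
  let ?Y = "sqrt_iter D"
  define Y where "Y x = lim (\<lambda>n. ?Y n x)" for x
  have lim: "(\<lambda>n. ?Y n x) \<longlonglongrightarrow> Y x" for x
    unfolding Y_def using Cauchy_sqrt_iter[of x] Cauchy_convergent_iff convergent_LIMSEQ_iff by blast
  have lin: "linear Y"
  proof (rule linearI)
    show "Y (x + y) = Y x + Y y" for x y
      using LIMSEQ_unique[OF lim[of "x + y"]] tendsto_add[OF lim[of x] lim[of y]]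
      by (simp add: linear_add[OF linear_sqrt_iter])
    show "Y (c *\<^sub>R x) = c *\<^sub>R Y x" for c x
      using LIMSEQ_unique[OF lim[of "c *\<^sub>R x"]] tendsto_scaleR[OF tendsto_const lim[of x]]
      by (simp add: linear_scale[OF linear_sqrt_iter])
  qed
  have le1: "norm (?Y n x) \<le> norm x" for n x
    using norm_sqrt_iter_le[of n x] sqrt_bound_range[of n] mult_right_mono[of "sqrt_bound n" 1 "norm x"]
    by simp
  have leY: "norm (Y x) \<le> norm x" for x
    using tendsto_norm[OF lim[of x]] le1 by (intro LIMSEQ_le_const2) blast+
  \<comment> \<open>Convergence is only pointwise, so the outer iterate is controlled by the uniform
    bound \<open>le1\<close>: it is applied to a null sequence, and at the fixed vector
    \<open>Y x\<close> it converges.\<close>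
  have YY: "(\<lambda>n. ?Y n (?Y n x)) \<longlonglongrightarrow> Y (Y x)" for x
  proof (rule Lim_transform[OF lim[of "Y x"]])
    have "(\<lambda>n. ?Y n x - Y x) \<longlonglongrightarrow> 0" using lim[of x] LIM_zero by blast
    then have "(\<lambda>n. ?Y n (?Y n x - Y x)) \<longlonglongrightarrow> 0"
      by (rule Lim_null_comparison[rotated, OF tendsto_norm_zero]) (intro always_eventually allI le1)
    then show "(\<lambda>n. ?Y n (?Y n x) - ?Y n (Y x)) \<longlonglongrightarrow> 0"
      by (simp add: linear_diff[OF linear_sqrt_iter])
  qed
  have fix_eq: "Y x = (1/2) *\<^sub>R (D x + Y (Y x))" for x
  proof -
    have "(\<lambda>n. ?Y (Suc n) x) \<longlonglongrightarrow> (1/2) *\<^sub>R (D x + Y (Y x))"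
      by (simp del: scaleR_add_right) (intro tendsto_intros YY)
    then show ?thesis using LIMSEQ_Suc[OF lim[of x]] LIMSEQ_unique by blast
  qed
  define S where "S x = x - Y x" for x
  have "bounded_linear S"
  proof (rule bounded_linear_intro[where K = 2])
    show "norm (S x) \<le> norm x * 2" for x
      unfolding S_def using norm_triangle_ineq4[of x "Y x"] leY[of x] by simp
  qed (simp_all add: S_def linear_add[OF lin] linear_scale[OF lin] algebra_simps)
  moreover have "S (S x) = x - D x" for x
  proof -
    have "2 *\<^sub>R Y x = D x + Y (Y x)" using fix_eq[of x] by (metis scaleR_half_double scaleR_2 scaleR_add_right)
    then show ?thesis unfolding S_def by (simp add: linear_diff[OF lin] scaleR_2 algebra_simps)
  qed
  moreover have "0 \<le> S x \<bullet> x" for x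
  proof -
    have "Y x \<bullet> x \<le> norm (Y x) * norm x" by (rule norm_cauchy_schwarz)
    also have "\<dots> \<le> norm x * norm x" using leY by (intro mult_right_mono) auto
    finally show ?thesis unfolding S_def by (simp add: inner_diff_left dot_square_norm power2_eq_square)
  qed
  moreover have "L (S x) = S (L x)" if L: "bounded_linear L" "\<And>x. L (D x) = D (L x)" for L x
  proof -
    have lL: "linear L" using L(1) by (simp add: bounded_linear.linear)
    have "(\<lambda>n. L (?Y n x)) \<longlonglongrightarrow> L (Y x)" using bounded_linear.tendsto[OF L(1) lim] .
    then have "L (Y x) = Y (L x)"
      using sqrt_iter_commute[OF lL L(2)] lim[of "L x"] LIMSEQ_unique by fastforce
    then show ?thesis unfolding S_def by (simp add: linear_diff[OF lL])
  qed
  ultimately show ?thesis using that by blast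
qed

end

text \<open>With \<open>T = A - \<epsilon>\<close> and \<open>S = \<bar>T\<bar>\<close>, the subspace is the kernel of \<open>S - T\<close>: there \<open>T \<ge> 0\<close>.  It
  contains the range of \<open>S + T\<close>, so it vanishes only if \<open>T \<le> 0\<close>.\<close>

lemma positive_operator_bounded_below_subspace:
  fixes A :: "'h::{real_inner,complete_space} \<Rightarrow> 'h"
  assumes A: "linear A" "\<And>x y. A x \<bullet> y = x \<bullet> A y" "\<And>x. 0 \<le> A x \<bullet> x"
    "\<And>x. A x \<bullet> x \<le> (norm x)\<^sup>2" and nz: "A x0 \<bullet> x0 \<noteq> 0"
  obtains \<epsilon> V where "\<epsilon> > 0" "closed V" "subspace V" "V \<noteq> {0}"
    "\<And>x. x \<in> V \<Longrightarrow> \<epsilon> * (norm x)\<^sup>2 \<le> A x \<bullet> x"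
    "\<And>L x. bounded_linear L \<Longrightarrow> (\<And>x. L (A x) = A (L x)) \<Longrightarrow> x \<in> V \<Longrightarrow> L x \<in> V"
proof -
  \<comment> \<open>Half the Rayleigh quotient at \<open>x0\<close>: this keeps
    \<open>T x0 \<bullet> x0\<close> positive, and \<open>A \<le> 1\<close> gives
    \<open>\<epsilon> \<le> 1/2\<close>.\<close>
  define \<epsilon> where "\<epsilon> = (A x0 \<bullet> x0) / (2 * (norm x0)\<^sup>2)"
  have x0: "x0 \<noteq> 0" using nz by auto
  have eps: "0 < \<epsilon>" "\<epsilon> \<le> 1/2"
    using A(3)[of x0] A(4)[of x0] nz x0 unfolding \<epsilon>_def by (auto simp: field_simps)
  have x0_eps: "A x0 \<bullet> x0 > \<epsilon> * (norm x0)\<^sup>2"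
    using A(3)[of x0] nz x0 unfolding \<epsilon>_def by (simp add: field_simps)
  define T where "T x = A x - \<epsilon> *\<^sub>R x" for x
  have bA: "bounded_linear A" using positive_contraction_bounded_linear[OF A] .
  have bT: "bounded_linear T"
    unfolding T_def by (intro bounded_linear_sub bA bounded_linear_scaleR_right)
  then have lT: "linear T" by (rule bounded_linear.linear)
  have symT: "T x \<bullet> y = x \<bullet> T y" for x y
    unfolding T_def using A(2) by (simp add: inner_diff_left inner_diff_right)
  \<comment> \<open>The square of \<open>A\<close> is at most \<open>A\<close>, and
    \<open>1 - 2 * \<epsilon>\<close> is non-negative, so the square of \<open>T\<close> is at most
    that of \<open>1 - \<epsilon>\<close>.\<close>
  have normT: "norm (T x) \<le> norm x" for x
  proof (rule power2_le_imp_le)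
    have "(norm (T x))\<^sup>2 = (norm (A x))\<^sup>2 - 2 * \<epsilon> * (A x \<bullet> x) + \<epsilon>\<^sup>2 * (norm x)\<^sup>2"
      unfolding T_def power2_norm_eq_inner
      by (simp add: inner_diff_left inner_diff_right inner_commute power2_eq_square algebra_simps)
    also have "\<dots> \<le> (1 - 2 * \<epsilon>) * (A x \<bullet> x) + \<epsilon>\<^sup>2 * (norm x)\<^sup>2"
      using positive_contraction_norm_sq_le[OF A, of x] by (simp add: algebra_simps)
    also have "\<dots> \<le> (1 - 2 * \<epsilon>) * (norm x)\<^sup>2 + \<epsilon>\<^sup>2 * (norm x)\<^sup>2"
      using A(4)[of x] eps by (intro add_right_mono mult_left_mono) auto
    also have "\<dots> = (1 - \<epsilon>)\<^sup>2 * (norm x)\<^sup>2" by (simp add: power2_eq_square algebra_simps)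
    also have "\<dots> \<le> 1 * (norm x)\<^sup>2" using eps by (intro mult_right_mono power_le_one) auto
    finally show "(norm (T x))\<^sup>2 \<le> (norm x)\<^sup>2" by simp
  qed simp
  \<comment> \<open>With this choice \<open>1 - D\<close> is the square of \<open>T\<close>, so the
    square root \<open>S\<close> is the absolute value of \<open>T\<close>; whatever commutes with
    \<open>A\<close> commutes with \<open>T\<close>, with \<open>D\<close> and hence with
    \<open>S\<close>.\<close>
  define D where "D x = x - T (T x)" for x
  have lD: "linear D" unfolding D_def by (auto intro!: linearI simp: linear_add[OF lT] linear_scale[OF lT] algebra_simps)
  have D2: "D x \<bullet> x = (norm x)\<^sup>2 - (norm (T x))\<^sup>2" for x
    unfolding D_def by (simp add: inner_diff_left symT power2_norm_eq_inner)
  have normD: "norm (D x) \<le> norm x" for x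
  proof (rule positive_contraction_norm_le[OF lD])
    show "D x \<bullet> y = x \<bullet> D y" for x y unfolding D_def by (simp add: inner_diff_left inner_diff_right symT)
    show "0 \<le> D x \<bullet> x" for x unfolding D2 using normT by (simp add: power_mono)
    show "D x \<bullet> x \<le> (norm x)\<^sup>2" for x unfolding D2 by simp
  qed
  obtain S where S: "bounded_linear S" "\<And>x. S (S x) = x - D x" "\<And>x. 0 \<le> S x \<bullet> x"
    "\<And>L x. bounded_linear L \<Longrightarrow> (\<And>x. L (D x) = D (L x)) \<Longrightarrow> L (S x) = S (L x)"
    using sqrt_one_minus_contraction[OF lD normD] by blast
  have lS: "linear S" using S(1) by (rule bounded_linear.linear)
  define V where "V = {x. S x = T x}"
  have V_inv: "L x \<in> V" if L: "bounded_linear L" "\<And>x. L (A x) = A (L x)" and x: "x \<in> V" for L x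
  proof -
    have lL: "linear L" using L(1) by (rule bounded_linear.linear)
    have LT: "L (T x) = T (L x)" for x
      unfolding T_def using L(2) by (simp add: linear_diff[OF lL] linear_scale[OF lL])
    have "L (D x) = D (L x)" for x unfolding D_def by (simp add: linear_diff[OF lL] LT)
    then have "L (S x) = S (L x)" using S(4) L(1) by blast
    then show ?thesis using x LT unfolding V_def by simp
  qed
  have TS: "T (S x) = S (T x)" for x
  proof (rule S(4)[OF bT])
    show "T (D x) = D (T x)" for x unfolding D_def by (simp add: linear_diff[OF lT])
  qed
  have SS: "S (S x) = T (T x)" for x using S(2) by (simp add: D_def)
  have "closed V" unfolding V_def
    by (intro closed_Collect_eq linear_continuous_on S(1) bT)
  moreover have "subspace V" unfolding V_def subspace_def
    by (simp add: linear_0 linear_add linear_scale lS lT)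
  moreover have "V \<noteq> {0}"
  proof
    assume "V = {0}"
    moreover have "S x0 + T x0 \<in> V"
      unfolding V_def by (simp add: linear_add[OF lS] linear_add[OF lT] SS TS)
    ultimately have "S x0 = - T x0" by (simp add: eq_neg_iff_add_eq_0)
    then have "T x0 \<bullet> x0 \<le> 0" using S(3)[of x0] by simp
    then show False using x0_eps unfolding T_def by (simp add: inner_diff_left power2_norm_eq_inner)
  qed
  moreover have "\<epsilon> * (norm x)\<^sup>2 \<le> A x \<bullet> x" if "x \<in> V" for x
    using S(3)[of x] that unfolding V_def T_def by (simp add: inner_diff_left power2_norm_eq_inner)
  ultimately show ?thesis using that eps(1) V_inv by blast
qed

subsection \<open>Functions conditionally of negative type\<close>

text \<open>Schoenberg's argument: the identity is appended with weight \<open>- L\<close>, which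
  makes the weights sum to zero, and the negative type inequality for the longer family rearranges
  to positivity of this kernel.\<close>

lemma cond_neg_type_kernel_nonneg:
  fixes g :: "nat \<Rightarrow> 'g::topological_group_add"
  assumes "cond_neg_type \<psi>"
  shows "0 \<le> (\<Sum>k<n. \<Sum>m<n. l k * l m * ((\<psi> (g k) + \<psi> (g m) - \<psi> (- g k + g m)) / 2))"
proof -
  have \<psi>: "\<psi> 0 = 0" "\<And>x. \<psi> (- x) = \<psi> x"
    and neg: "\<And>(n::nat) g l. n \<ge> 1 \<Longrightarrow> (\<Sum>i<n. l i) = 0 \<Longrightarrow>
      (\<Sum>i<n. \<Sum>j<n. l i * l j * \<psi> (- g i + g j)) \<le> 0"
    using assms unfolding cond_neg_type_def by blast+
  define L where "L = (\<Sum>k<n. l k)"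
  define P where "P = (\<Sum>k<n. l k * \<psi> (g k))"
  define Q where "Q = (\<Sum>k<n. \<Sum>m<n. l k * l m * \<psi> (- g k + g m))"
  let ?l = "l(n := - L)" and ?g = "g(n := 0)"
  have "(\<Sum>i<Suc n. ?l i) = 0" by (simp add: L_def)
  then have "(\<Sum>i<Suc n. \<Sum>j<Suc n. ?l i * ?l j * \<psi> (- ?g i + ?g j)) \<le> 0" by (intro neg) auto
  also have "(\<Sum>i<Suc n. \<Sum>j<Suc n. ?l i * ?l j * \<psi> (- ?g i + ?g j)) =
      Q + (\<Sum>i<n. l i * - L * \<psi> (g i)) + (\<Sum>j<n. - L * l j * \<psi> (g j))"
    by (simp add: \<psi> sum_subtractf sum_negf Q_def)
  also have "(\<Sum>i<n. l i * - L * \<psi> (g i)) = - L * P"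
    unfolding P_def sum_distrib_left by (intro sum.cong) auto
  also have "(\<Sum>j<n. - L * l j * \<psi> (g j)) = - L * P"
    unfolding P_def sum_distrib_left by (intro sum.cong) auto
  finally have le: "Q \<le> 2 * (L * P)" by simp
  have 1: "(\<Sum>k<n. \<Sum>m<n. l k * l m * \<psi> (g k)) = P * L"
    unfolding L_def P_def sum_product
    by (intro sum.cong) (auto simp: mult_ac)
  have 2: "(\<Sum>k<n. \<Sum>m<n. l k * l m * \<psi> (g m)) = L * P"
    unfolding L_def P_def sum_product by (intro sum.cong) (auto simp: mult_ac)
  have "(\<Sum>k<n. \<Sum>m<n. l k * l m * ((\<psi> (g k) + \<psi> (g m) - \<psi> (- g k + g m)) / 2)) =
      (\<Sum>k<n. \<Sum>m<n. (l k * l m * \<psi> (g k) + l k * l m * \<psi> (g m) - l k * l m * \<psi> (- g k + g m)) / 2)"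
    by (simp add: algebra_simps)
  also have "\<dots> = (P * L + L * P - Q) / 2"
    unfolding sum_divide_distrib[symmetric] sum_subtractf sum.distrib 1 2 Q_def ..
  finally show ?thesis using le by simp
qed

text \<open>The diagonal of the positive kernel above is \<open>\<psi>\<close> itself.\<close>

lemma cond_neg_type_nonneg:
  fixes g :: "'g::topological_group_add"
  assumes "cond_neg_type \<psi>"
  shows "0 \<le> \<psi> g"
  using cond_neg_type_kernel_nonneg[OF assms, of "\<lambda>_. 1" "\<lambda>_. g" 1] assms
  by (simp add: cond_neg_type_def)

section \<open>The cone \<open>cone_C\<close> and its faces\<close>

lemma cond_neg_type_add:
  assumes "cond_neg_type \<psi>" "cond_neg_type \<phi>"
  shows "cond_neg_type (\<lambda>g. \<psi> g + \<phi> g)"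
  using assms unfolding cond_neg_type_def
  by (auto simp: distrib_left sum.distrib intro!: continuous_on_add add_nonpos_nonpos)

lemma cond_neg_type_scale:
  assumes "cond_neg_type \<psi>" "0 \<le> t"
  shows "cond_neg_type (\<lambda>g. t * \<psi> g)"
proof -
  have "(\<Sum>i<n. \<Sum>j<n. l i * l j * (t * \<psi> (- g i + g j))) =
      t * (\<Sum>i<n. \<Sum>j<n. l i * l j * \<psi> (- g i + g j))" for n :: nat and l g
    by (simp add: sum_distrib_left mult.left_commute)
  then show ?thesis using assms unfolding cond_neg_type_def
    by (auto intro!: continuous_on_mult_left mult_nonneg_nonpos)
qed

lemma cond_neg_type_zero: "cond_neg_type (\<lambda>_. 0)"
  by (simp add: cond_neg_type_def)

text \<open>A face of \<open>cone_C\<close> through \<open>\<psi>\<close> contains every summand of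
  \<open>\<psi>\<close>. Conversely, unboundedness of the summands is what puts the face generated
  by \<open>\<psi>\<close> inside \<open>cone_Cu\<close>.\<close>

lemma common_face_iff:
  assumes \<psi>: "cond_neg_type \<psi>"
  shows "(\<exists>F. cone_face F cone_C \<and> cone_face F cone_Cu \<and> \<psi> \<in> F) \<longleftrightarrow>
    (\<forall>\<psi>\<^sub>0 \<psi>\<^sub>1. cond_neg_type \<psi>\<^sub>0 \<and> cond_neg_type \<psi>\<^sub>1 \<and>
       \<psi> = (\<lambda>g. \<psi>\<^sub>0 g + \<psi>\<^sub>1 g) \<and> \<psi>\<^sub>0 \<noteq> (\<lambda>_. 0) \<longrightarrow> \<not> bounded (range \<psi>\<^sub>0))" (is "?L \<longleftrightarrow> ?R")
proof
  assume ?L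
  then obtain F where F: "cone_face F cone_C" "cone_face F cone_Cu" "\<psi> \<in> F" by blast
  show ?R
  proof (intro allI impI, elim conjE)
    fix \<psi>\<^sub>0 \<psi>\<^sub>1
    assume *: "cond_neg_type \<psi>\<^sub>0" "cond_neg_type \<psi>\<^sub>1" "\<psi> = (\<lambda>g. \<psi>\<^sub>0 g + \<psi>\<^sub>1 g)" "\<psi>\<^sub>0 \<noteq> (\<lambda>_. 0)"
    then have "\<psi>\<^sub>0 \<in> F" using F(1,3) unfolding cone_face_def cone_C_def by blast
    then have "\<psi>\<^sub>0 \<in> cone_Cu" using F(2) unfolding cone_face_def by blast
    then show "\<not> bounded (range \<psi>\<^sub>0)" using *(4) unfolding cone_Cu_def by blast
  qed
next
  assume R: ?R
  \<comment> \<open>The functions dominated by a multiple of \<open>\<psi>\<close> in the order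
    given by \<open>cone_C\<close>; \<open>\<psi>\<^sub>1\<close> is the remainder.\<close>
  define F where "F = {\<psi>\<^sub>0. cond_neg_type \<psi>\<^sub>0 \<and>
    (\<exists>\<psi>\<^sub>1 t. cond_neg_type \<psi>\<^sub>1 \<and> 0 \<le> t \<and> (\<forall>g. \<psi>\<^sub>0 g + \<psi>\<^sub>1 g = t * \<psi> g))}"
  have FI: "\<psi>\<^sub>0 \<in> F" if "cond_neg_type \<psi>\<^sub>0" "cond_neg_type \<psi>\<^sub>1" "0 \<le> t" "\<And>g. \<psi>\<^sub>0 g + \<psi>\<^sub>1 g = t * \<psi> g" for \<psi>\<^sub>0 \<psi>\<^sub>1 t
    using that unfolding F_def by blast
  have FE: "\<exists>\<psi>\<^sub>1 t. cond_neg_type \<psi>\<^sub>0 \<and> cond_neg_type \<psi>\<^sub>1 \<and> 0 \<le> t \<and> (\<forall>g. \<psi>\<^sub>0 g + \<psi>\<^sub>1 g = t * \<psi> g)"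
    if "\<psi>\<^sub>0 \<in> F" for \<psi>\<^sub>0
    using that unfolding F_def by blast
  have \<psi>F: "\<psi> \<in> F" using FI[OF \<psi> cond_neg_type_zero, of 1] by simp
  have cone: "fun_convex_cone F"
    unfolding fun_convex_cone_def
  proof (intro conjI ballI allI impI)
    show "F \<noteq> {}" using \<psi>F by blast
    show "(\<lambda>g. x g + y g) \<in> F" if xy: "x \<in> F" "y \<in> F" for x y
    proof -
      obtain x1 t where x: "cond_neg_type x" "cond_neg_type x1" "0 \<le> t" "\<forall>g. x g + x1 g = t * \<psi> g"
        using FE[OF xy(1)] by blast
      obtain y1 s where y: "cond_neg_type y" "cond_neg_type y1" "0 \<le> s" "\<forall>g. y g + y1 g = s * \<psi> g"
        using FE[OF xy(2)] by blast
      have "x g + y g + (x1 g + y1 g) = (t + s) * \<psi> g" for g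
        using x(4)[rule_format, of g] y(4)[rule_format, of g] by (simp add: algebra_simps)
      then show ?thesis
        using x y by (intro FI[of _ "\<lambda>g. x1 g + y1 g" "t + s"] cond_neg_type_add) auto
    qed
    show "(\<lambda>g. s * x g) \<in> F" if xs: "x \<in> F" "0 \<le> s" for x s
    proof -
      obtain x1 t where x: "cond_neg_type x" "cond_neg_type x1" "0 \<le> t" "\<forall>g. x g + x1 g = t * \<psi> g"
        using FE[OF xs(1)] by blast
      have "s * x g + s * x1 g = (s * t) * \<psi> g" for g
        using x(4)[rule_format, of g] by (metis distrib_left mult.assoc)
      then show ?thesis
        using x xs by (intro FI[of _ "\<lambda>g. s * x1 g" "s * t"] cond_neg_type_scale) auto
    qed
  qed
  have face: "x \<in> F" if xy: "cond_neg_type x" "cond_neg_type y" "(\<lambda>g. x g + y g) \<in> F" for x y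
  proof -
    obtain z t where z: "cond_neg_type z" "0 \<le> t" "\<forall>g. x g + y g + z g = t * \<psi> g"
      using FE[OF xy(3)] by blast
    show ?thesis
      using xy z by (intro FI[of _ "\<lambda>g. y g + z g" t] cond_neg_type_add) (auto simp: add.assoc)
  qed
  have face2: "y \<in> F" if "cond_neg_type x" "cond_neg_type y" "(\<lambda>g. x g + y g) \<in> F" for x y
    using face[of y x] that by (simp add: add.commute)
  have sub: "F \<subseteq> cone_Cu"
  proof
    fix \<psi>\<^sub>0 assume "\<psi>\<^sub>0 \<in> F"
    then obtain \<psi>\<^sub>1 t where *: "cond_neg_type \<psi>\<^sub>0" "cond_neg_type \<psi>\<^sub>1" "0 \<le> t" "\<forall>g. \<psi>\<^sub>0 g + \<psi>\<^sub>1 g = t * \<psi> g"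
      using FE by blast
    show "\<psi>\<^sub>0 \<in> cone_Cu"
    proof (cases "\<psi>\<^sub>0 = (\<lambda>_. 0)")
      case False
      \<comment> \<open>For \<open>t = 0\<close> two non-negative functions would add up to
        zero.\<close>
      have "t \<noteq> 0"
      proof
        assume "t = 0"
        then have "\<psi>\<^sub>0 g = 0" for g
          using *(4)[rule_format, of g] cond_neg_type_nonneg[OF *(1), of g] cond_neg_type_nonneg[OF *(2), of g]
          by simp
        then show False using False by blast
      qed
      then have t: "t > 0" using *(3) by simp
      \<comment> \<open>Dividing by \<open>t\<close> turns the domination into a decomposition of
        \<open>\<psi>\<close> itself, without affecting boundedness.\<close>
      let ?\<phi> = "\<lambda>g. (1 / t) * \<psi>\<^sub>0 g"
      have "\<not> bounded (range ?\<phi>)"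
      proof (rule R[rule_format, of _ "\<lambda>g. (1 / t) * \<psi>\<^sub>1 g"], intro conjI)
        show "cond_neg_type ?\<phi>" "cond_neg_type (\<lambda>g. (1 / t) * \<psi>\<^sub>1 g)"
          using *(1,2) t by (intro cond_neg_type_scale; simp)+
        show "\<psi> = (\<lambda>g. (1 / t) * \<psi>\<^sub>0 g + (1 / t) * \<psi>\<^sub>1 g)"
          using *(4) t by (simp add: fun_eq_iff add_divide_distrib[symmetric])
        show "?\<phi> \<noteq> (\<lambda>_. 0)" using False t by (auto simp: fun_eq_iff)
      qed
      moreover have "bounded (range ?\<phi>)" if "bounded (range \<psi>\<^sub>0)"
        using bounded_scaling[OF that, of "1 / t"] by (simp add: image_image)
      ultimately show ?thesis using *(1) unfolding cone_Cu_def cone_C_def by blast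
    qed (simp add: cone_Cu_def)
  qed
  have Cu: "cone_Cu \<subseteq> {\<psi>. cond_neg_type \<psi>}"
    unfolding cone_Cu_def cone_C_def using cond_neg_type_zero by blast
  have "cone_face F cone_C"
    unfolding cone_face_def using cone face face2 by (auto simp: cone_C_def F_def)
  \<comment> \<open>Since \<open>cone_Cu\<close> lies in \<open>cone_C\<close>, the face condition
    in the larger cone covers all pairs from the smaller one.\<close>
  moreover have "cone_face F cone_Cu"
    unfolding cone_face_def using cone sub face face2 Cu by blast
  ultimately show ?L using \<psi>F by blast
qed

subsection \<open>Affine isometric actions\<close>

lemma direct_sum_decomposition_orth_proj:
  fixes V\<^sub>0 :: "'h::{real_inner,complete_space} set"
  assumes "direct_sum_decomposition \<pi> V\<^sub>0 V\<^sub>1" "x \<in> V\<^sub>0" "y \<in> V\<^sub>1"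
  shows "orth_proj V\<^sub>0 (x + y) = x"
  using assms unfolding direct_sum_decomposition_def subrep_def
  by (intro orth_proj_eqI) (auto simp: orthogonal_def inner_commute)

lemma irreducible_action_onD:
  assumes "irreducible_action_on V \<alpha>"
    and "W \<noteq> {}" "closed W" "affine W" "W \<subseteq> V" "\<And>g. \<alpha> g ` W \<subseteq> W"
  shows "W = V"
  using assms unfolding irreducible_action_on_def by (meson psubsetI)

locale affine_isometric_action =
  fixes \<pi> :: "'g::topological_group_add \<Rightarrow> 'h::{real_inner,complete_space} \<Rightarrow> 'h"
    and b :: "'g \<Rightarrow> 'h"
  assumes rep: "unitary_rep \<pi>" and cocycle: "b \<in> cocycles \<pi>"
begin

section \<open>Unitary operators and cocycle identities\<close>

lemma linear_rep: "linear (\<pi> g)"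
  and rep_inner: "\<pi> g x \<bullet> \<pi> g y = x \<bullet> y"
  and rep_zero: "\<pi> 0 x = x"
  and rep_add: "\<pi> (g + h) x = \<pi> g (\<pi> h x)"
  using rep unfolding unitary_rep_def orthogonal_transformation_def by auto

lemma rep_norm: "norm (\<pi> g x) = norm x"
  by (simp add: norm_eq_sqrt_inner rep_inner)

lemma bounded_linear_rep: "bounded_linear (\<pi> g)"
  using linear_rep rep_norm
  by (intro bounded_linear_intro[where K = 1]) (auto simp: linear_add linear_scale)

lemma rep_minus_cancel: "\<pi> (- g) (\<pi> g x) = x" "\<pi> g (\<pi> (- g) x) = x"
  by (simp_all flip: rep_add add: rep_zero)

lemma rep_adjoint: "\<pi> g x \<bullet> y = x \<bullet> \<pi> (- g) y"
  using rep_inner[of g x "\<pi> (- g) y"] by (simp add: rep_minus_cancel)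

lemma cocycle_add: "c \<in> cocycles \<pi> \<Longrightarrow> c (g + h) = c g + \<pi> g (c h)"
  by (simp add: cocycles_def)

lemma cocycle_zero: "c \<in> cocycles \<pi> \<Longrightarrow> c 0 = 0"
  using cocycle_add[of c 0 0] by (simp add: rep_zero)

lemma cocycle_minus: "c \<in> cocycles \<pi> \<Longrightarrow> c (- g) = - \<pi> (- g) (c g)"
  using cocycle_add[of c "- g" g] cocycle_zero[of c] by (simp add: eq_neg_iff_add_eq_0)

lemma cocycle_norm_diff:
  assumes "c \<in> cocycles \<pi>"
  shows "norm (c (- g + h)) = norm (c h - c g)"
proof -
  have "c (- g + h) = \<pi> (- g) (c h - c g)"
    using assms by (simp only: cocycle_add cocycle_minus linear_diff[OF linear_rep]) simp
  then show ?thesis by (simp add: rep_norm)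
qed

text \<open>Polarisation: the Gram kernel of a cocycle is the positive kernel belonging to its
  squared norm, which links operators on the Hilbert space with functions of negative type.\<close>

lemma cocycle_inner:
  assumes "c \<in> cocycles \<pi>"
  shows "c g \<bullet> c h = ((norm (c g))\<^sup>2 + (norm (c h))\<^sup>2 - (norm (c (- g + h)))\<^sup>2) / 2"
  unfolding cocycle_norm_diff[OF assms] power2_norm_eq_inner
  by (simp add: inner_diff_left inner_diff_right inner_commute)

text \<open>In the expansion of the squared distances the two diagonal terms carry the factor
  \<open>\<Sum>i<n. l i\<close>, which vanishes; what remains is \<open>-2\<close> times a squared
  norm.\<close>

lemma cond_neg_type_norm_sq:
  assumes c: "c \<in> cocycles \<pi>"
  shows "cond_neg_type (\<lambda>g. (norm (c g))\<^sup>2)"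
  unfolding cond_neg_type_def
proof (intro conjI allI impI)
  show "continuous_on UNIV (\<lambda>g. (norm (c g))\<^sup>2)"
    using c by (auto simp: cocycles_def intro!: continuous_intros)
  show "(norm (c 0))\<^sup>2 = 0" using cocycle_zero[OF c] by simp
  show "(norm (c (- g)))\<^sup>2 = (norm (c g))\<^sup>2" for g
    using cocycle_minus[OF c] by (simp add: rep_norm)
  fix n and g :: "nat \<Rightarrow> 'g" and l :: "nat \<Rightarrow> real"
  assume l: "(\<Sum>i<n. l i) = 0"
  let ?N = "\<lambda>i. (norm (c (g i)))\<^sup>2"
  have norm_sq: "(norm (c (- g i + g j)))\<^sup>2 = ?N i + ?N j - 2 * (c (g i) \<bullet> c (g j))" for i j
    by (simp add: cocycle_inner[OF c] field_simps)
  have "(\<Sum>i<n. \<Sum>j<n. l i * l j * (norm (c (- g i + g j)))\<^sup>2) =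
      (\<Sum>i<n. \<Sum>j<n. l i * l j * ?N i + l i * l j * ?N j - 2 * (l i * (l j * (c (g i) \<bullet> c (g j)))))"
    by (simp add: norm_sq algebra_simps)
  also have "\<dots> = (\<Sum>i<n. \<Sum>j<n. l i * l j * ?N i) + (\<Sum>i<n. \<Sum>j<n. l i * l j * ?N j)
      - 2 * (\<Sum>i<n. \<Sum>j<n. l i * (l j * (c (g i) \<bullet> c (g j))))"
    by (simp add: sum_subtractf sum.distrib sum_distrib_left)
  also have "(\<Sum>i<n. \<Sum>j<n. l i * l j * ?N i) = (\<Sum>i<n. l i * ?N i) * (\<Sum>j<n. l j)"
    unfolding sum_product by (intro sum.cong) (auto simp: mult_ac)
  also have "(\<Sum>i<n. \<Sum>j<n. l i * l j * ?N j) = (\<Sum>i<n. l i) * (\<Sum>j<n. l j * ?N j)"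
    unfolding sum_product by (intro sum.cong) (auto simp: mult_ac)
  also have "(\<Sum>i<n. \<Sum>j<n. l i * (l j * (c (g i) \<bullet> c (g j)))) = (norm (\<Sum>i<n. l i *\<^sub>R c (g i)))\<^sup>2"
    unfolding power2_norm_eq_inner by (simp add: inner_sum_left inner_sum_right sum_distrib_left inner_commute mult.left_commute)
  finally show "(\<Sum>i<n. \<Sum>j<n. l i * l j * (norm (c (- g i + g j)))\<^sup>2) \<le> 0" using l by simp
qed

section \<open>Sub-representations, complements and projected cocycles\<close>

lemma subrepD: "subrep \<pi> V \<Longrightarrow> closed V" "subrep \<pi> V \<Longrightarrow> subspace V"
  "subrep \<pi> V \<Longrightarrow> x \<in> V \<Longrightarrow> \<pi> g x \<in> V"
  by (auto simp: subrep_def)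

text \<open>Invariance of \<open>V\<close> under \<open>\<pi> (- g)\<close>, the adjoint of
  \<open>\<pi> g\<close>, keeps the component orthogonal to \<open>V\<close> orthogonal.\<close>

lemma orth_proj_rep:
  assumes V: "subrep \<pi> V"
  shows "orth_proj V (\<pi> g x) = \<pi> g (orth_proj V x)"
proof (rule orth_proj_eqI)
  note [simp] = subrepD(1,2)[OF V]
  show "subspace V" by simp
  show "\<pi> g (orth_proj V x) \<in> V" using V by (intro subrepD(3) orth_proj_in) auto
  fix z assume "z \<in> V"
  then have "\<pi> (- g) z \<in> V" using V subrepD(3) by blast
  then have "(x - orth_proj V x) \<bullet> \<pi> (- g) z = 0" by (intro orth_proj_orth) auto
  then show "(\<pi> g x - \<pi> g (orth_proj V x)) \<bullet> z = 0"
    by (simp add: rep_adjoint flip: linear_diff[OF linear_rep])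
qed

lemma orth_proj_cocycle:
  assumes V: "subrep \<pi> V" and c: "c \<in> cocycles \<pi>"
  shows "(\<lambda>g. orth_proj V (c g)) \<in> cocycles \<pi>"
proof -
  note V' = subrepD(1,2)[OF V]
  have "continuous_on UNIV (\<lambda>g. orth_proj V (c g))"
    using c unfolding cocycles_def
    by (auto intro: bounded_linear.continuous_on[OF bounded_linear_orth_proj[OF V']])
  then show ?thesis using c
    by (simp add: cocycles_def linear_add[OF linear_orth_proj[OF V']] orth_proj_rep[OF V])
qed

lemma cocycle_diff: "c \<in> cocycles \<pi> \<Longrightarrow> d \<in> cocycles \<pi> \<Longrightarrow> (\<lambda>g. c g - d g) \<in> cocycles \<pi>"
  by (auto simp: cocycles_def linear_diff[OF linear_rep] intro: continuous_on_diff)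

lemma subrep_orthogonal_comp:
  assumes "subrep \<pi> V"
  shows "subrep \<pi> (V\<^sup>\<bottom>)"
  unfolding subrep_def
proof (intro conjI allI)
  show "subspace (V\<^sup>\<bottom>)" by (rule subspace_orthogonal_comp)
  have "V\<^sup>\<bottom> = (\<Inter>y\<in>V. {x. y \<bullet> x = 0})" by (auto simp: orthogonal_comp_def orthogonal_def)
  then show "closed (V\<^sup>\<bottom>)"
    by (auto intro!: closed_INT closed_Collect_eq continuous_intros)
  show "\<pi> g ` (V\<^sup>\<bottom>) \<subseteq> V\<^sup>\<bottom>" for g
  proof -
    have "y \<bullet> \<pi> g x = 0" if "x \<in> V\<^sup>\<bottom>" "y \<in> V" for x y
      using that subrepD(3)[OF assms that(2), of "- g"] rep_adjoint[of "- g" y x]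
      by (auto simp: orthogonal_comp_def orthogonal_def)
    then show ?thesis by (auto simp: orthogonal_comp_def orthogonal_def)
  qed
qed

lemma direct_sum_decomposition_orthogonal_comp:
  assumes V: "subrep \<pi> V"
  shows "direct_sum_decomposition \<pi> V (V\<^sup>\<bottom>)"
    and "x - orth_proj V x \<in> V\<^sup>\<bottom>"
proof -
  show *: "x - orth_proj V x \<in> V\<^sup>\<bottom>" for x
    using orth_proj_orth[OF subrepD(1,2)[OF V]]
    by (auto simp: orthogonal_comp_def orthogonal_def inner_commute)
  have "\<exists>x\<in>V. \<exists>y\<in>V\<^sup>\<bottom>. z = x + y" for z
    using *[of z] orth_proj_in[OF subrepD(1,2)[OF V], of z]
    by (intro bexI[of _ "orth_proj V z"] bexI[of _ "z - orth_proj V z"]) auto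
  then show "direct_sum_decomposition \<pi> V (V\<^sup>\<bottom>)"
    unfolding direct_sum_decomposition_def
    using V subrep_orthogonal_comp[OF V] by (auto simp: orthogonal_comp_def)
qed

text \<open>The values of \<open>c\<close> form the orbit of 0 under the affine action. Each of its
  isometries maps the orbit to itself and so fixes the unique Chebyshev centre in
  \<open>V\<close>.\<close>

lemma bounded_cocycle_fixed_point:
  assumes V: "subrep \<pi> V" and c: "c \<in> cocycles \<pi>" "range c \<subseteq> V" "bounded (range c)"
  obtains v where "v \<in> V" "\<And>g. \<pi> g v + c g = v"
proof -
  have V': "closed V" "convex V" "V \<noteq> {}"
    using subrepD(1,2)[OF V] by (auto simp: subspace_imp_convex dest: subspace_0)
  obtain v r where v: "v \<in> V" "range c \<subseteq> cball v r"
    and uniq: "\<And>x. x \<in> V \<Longrightarrow> range c \<subseteq> cball x r \<Longrightarrow> x = v"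
  proof (rule closed_convex_center[OF V' c(3)])
    show "range c \<noteq> {}" by simp
  qed (rule that)
  have "\<pi> g v + c g = v" for g
  proof (rule uniq)
    show "\<pi> g v + c g \<in> V" using v(1) V c(2) by (auto intro!: subspace_add subrepD)
    show "range c \<subseteq> cball (\<pi> g v + c g) r"
    proof clarify
      fix h
      \<comment> \<open>Every orbit point \<open>c h\<close> is the image under \<open>g\<close> of
        the orbit point \<open>c (- g + h)\<close>.\<close>
      have "c h = c g + \<pi> g (c (- g + h))" using cocycle_add[OF c(1), of g "- g + h"] by (simp add: add.assoc[symmetric])
      then have "dist (\<pi> g v + c g) (c h) = norm (\<pi> g (v - c (- g + h)))"
        by (simp add: dist_norm linear_diff[OF linear_rep])
      also have "\<dots> = dist v (c (- g + h))" by (simp add: rep_norm dist_norm)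
      also have "\<dots> \<le> r" using v(2) by fastforce
      finally show "c h \<in> cball (\<pi> g v + c g) r" by simp
    qed
  qed
  with that v(1) show ?thesis by blast
qed

section \<open>The equivalent forms of irreducibility\<close>

abbreviation irreducible_action :: bool where
  "irreducible_action \<equiv> irreducible_action_on UNIV (affine_action \<pi> b)"

text \<open>A3 in terms of the first summand alone: the summands are orthogonal, so the component of
  \<open>b\<close> in the first one is its projection, and every sub-representation is complemented
  by \<open>V\<^sup>\<bottom>\<close>.\<close>

definition projections_unbounded :: bool where
  "projections_unbounded \<longleftrightarrow>
     (\<forall>V. subrep \<pi> V \<and> V \<noteq> {0} \<longrightarrow> \<not> bounded (range (\<lambda>g. orth_proj V (b g))))"

lemma projections_unbounded_iff_decompositions:
  "projections_unbounded \<longleftrightarrow>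
    (\<forall>V\<^sub>0 V\<^sub>1 b\<^sub>0 b\<^sub>1. direct_sum_decomposition \<pi> V\<^sub>0 V\<^sub>1 \<and> V\<^sub>0 \<noteq> {0} \<and>
       (\<forall>g. b\<^sub>0 g \<in> V\<^sub>0 \<and> b\<^sub>1 g \<in> V\<^sub>1 \<and> b g = b\<^sub>0 g + b\<^sub>1 g) \<longrightarrow> \<not> bounded (range b\<^sub>0))"
  (is "_ \<longleftrightarrow> ?R")
proof
  assume P: projections_unbounded
  show ?R
  proof (intro allI impI, elim conjE)
    fix V\<^sub>0 V\<^sub>1 b\<^sub>0 b\<^sub>1
    assume *: "direct_sum_decomposition \<pi> V\<^sub>0 V\<^sub>1" "V\<^sub>0 \<noteq> {0}"
      "\<forall>g. b\<^sub>0 g \<in> V\<^sub>0 \<and> b\<^sub>1 g \<in> V\<^sub>1 \<and> b g = b\<^sub>0 g + b\<^sub>1 g"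
    then have "(\<lambda>g. orth_proj V\<^sub>0 (b g)) = b\<^sub>0"
      using direct_sum_decomposition_orth_proj[OF *(1)] by auto
    moreover have "subrep \<pi> V\<^sub>0" using *(1) by (simp add: direct_sum_decomposition_def)
    ultimately show "\<not> bounded (range b\<^sub>0)"
      using P *(2) unfolding projections_unbounded_def by metis
  qed
next
  assume R: ?R
  show projections_unbounded
    unfolding projections_unbounded_def
  proof (intro allI impI)
    fix V assume V: "subrep \<pi> V \<and> V \<noteq> {0}"
    have "\<forall>g. orth_proj V (b g) \<in> V \<and> b g - orth_proj V (b g) \<in> V\<^sup>\<bottom> \<and>
        b g = orth_proj V (b g) + (b g - orth_proj V (b g))"
      using V direct_sum_decomposition_orthogonal_comp(2) by (auto intro!: orth_proj_in subrepD)
    with R[rule_format, of V "V\<^sup>\<bottom>" "\<lambda>g. orth_proj V (b g)" "\<lambda>g. b g - orth_proj V (b g)"]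
    show "\<not> bounded (range (\<lambda>g. orth_proj V (b g)))"
      using V direct_sum_decomposition_orthogonal_comp(1) by blast
  qed
qed

text \<open>The cocycle \<open>b + \<partial>\<^sub>v\<close> is the displacement
  \<open>\<alpha>(g)v - v\<close>. The translate to \<open>v\<close> of the closed span of its
  values is the smallest closed invariant affine subspace through \<open>v\<close>.\<close>

lemma irreducible_iff_total:
  "irreducible_action \<longleftrightarrow> (\<forall>v. total_subset (range (\<lambda>g. b g + coboundary \<pi> v g)))" (is "_ \<longleftrightarrow> ?R")
proof
  assume irr: irreducible_action
  show ?R
  proof
    fix v
    define c where "c g = b g + coboundary \<pi> v g" for g
    define V where "V = closure (span (range c))"
    \<comment> \<open>The cocycle identity, read as a formula for \<open>\<pi> g (c h)\<close>,
      makes the span of the values invariant.\<close>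
    have c_add: "\<pi> g (c h) = c (g + h) - c g" for g h
      by (simp add: c_def coboundary_def cocycle_add[OF cocycle] rep_add
          linear_add[OF linear_rep] linear_diff[OF linear_rep])
    have V: "subspace V" "closed V" unfolding V_def by (auto intro: subspace_closure)
    have cV: "c g \<in> V" for g unfolding V_def by (meson closure_subset rangeI span_base subsetD)
    have span_inv: "\<pi> g ` span (range c) \<subseteq> span (range c)" for g
    proof -
      have "\<pi> g ` range c \<subseteq> span (range c)"
        by (auto simp: c_add intro!: span_diff[OF span_base span_base])
      then have "span (\<pi> g ` range c) \<subseteq> span (range c)" by (rule span_minimal) (rule subspace_span)
      then show ?thesis by (simp add: linear_span_image[OF linear_rep])
    qed
    have inv: "\<pi> g ` V \<subseteq> V" for g
      unfolding V_def
    proof (rule image_closure_subset)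
      show "continuous_on (closure (span (range c))) (\<pi> g)"
        by (rule linear_continuous_on[OF bounded_linear_rep])
      show "\<pi> g ` span (range c) \<subseteq> closure (span (range c))"
        using span_inv closure_subset by (rule order_trans)
    qed simp
    let ?W = "(+) v ` V"
    have "closed ?W" using V(2) by (rule closed_translation)
    moreover have "affine ?W"
      unfolding affine_translation[symmetric] using V(1) by (rule subspace_imp_affine)
    moreover have "?W \<noteq> {}" using subspace_0[OF V(1)] by blast
    moreover have "affine_action \<pi> b g ` ?W \<subseteq> ?W" for g
    proof -
      have "affine_action \<pi> b g (v + w) = v + (c g + \<pi> g w)" for w
        by (simp add: affine_action_def c_def coboundary_def linear_add[OF linear_rep])
      moreover have "c g + \<pi> g w \<in> V" if "w \<in> V" for w
        using that inv cV V(1) by (intro subspace_add) blast+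
      ultimately show ?thesis by auto
    qed
    ultimately have "?W = UNIV" by (intro irreducible_action_onD[OF irr]) auto
    then have "v + x \<in> ?W" for x by blast
    then have "V = UNIV" by (auto simp: image_iff)
    then show "total_subset (range (\<lambda>g. b g + coboundary \<pi> v g))"
      unfolding total_subset_def V_def c_def .
  qed
next
  assume R: ?R
  show irreducible_action
    unfolding irreducible_action_on_def
  proof (intro notI, elim exE conjE)
    fix W :: "'h set"
    assume "W \<noteq> {}"
    then obtain v where "v \<in> W" by blast
    moreover assume "closed W" "affine W" "W \<subset> UNIV" "\<forall>g. affine_action \<pi> b g ` W \<subseteq> W"
    ultimately have W: "v \<in> W" "closed W" "affine W" "W \<subset> UNIV"
      "\<forall>g. affine_action \<pi> b g ` W \<subseteq> W" by simp_all
    let ?V = "(\<lambda>x. x - v) ` W"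
    have V: "subspace ?V" "closed ?V"
      by (rule affine_diffs_subspace_subtract[OF W(3,1)], rule closed_translation_subtract[OF W(2)])
    have "b g + coboundary \<pi> v g \<in> ?V" for g
    proof -
      have "b g + coboundary \<pi> v g = affine_action \<pi> b g v - v"
        by (simp add: coboundary_def affine_action_def)
      then show ?thesis using W(1,5) by blast
    qed
    then have "closure (span (range (\<lambda>g. b g + coboundary \<pi> v g))) \<subseteq> ?V"
      using V by (intro closure_minimal span_minimal) auto
    then have "UNIV \<subseteq> ?V" using R unfolding total_subset_def by metis
    then have "x - v \<in> ?V" for x by blast
    then have "x \<in> W" for x by (auto simp: image_iff)
    then show False using W(4) by blast
  qed
qed

lemma irreducible_imp_total: "irreducible_action \<Longrightarrow> total_subset (range b)"
  using irreducible_iff_total by (auto simp: coboundary_def linear_0[OF linear_rep] dest: spec[of _ 0])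

text \<open>The projection onto \<open>V\<close> intertwines the affine action with the projected
  one, so preimages of invariant sets are invariant. \<open>W\<close> will be a fixed point for A3
  and an arbitrary invariant subspace for A6.\<close>

lemma orth_proj_preimage_invariant:
  assumes V: "subrep \<pi> V" and W: "closed W" "affine W"
    and inv: "\<And>g w. w \<in> W \<Longrightarrow> \<pi> g w + orth_proj V (b g) \<in> W"
  defines "U \<equiv> {x. orth_proj V x \<in> W}"
  shows "closed U" "affine U" "affine_action \<pi> b g ` U \<subseteq> U"
proof -
  note V' = subrepD(1,2)[OF V]
  note lin = linear_orth_proj[OF V']
  show "closed U" unfolding U_def
    using closed_vimage[OF W(1) linear_continuous_on[OF bounded_linear_orth_proj[OF V']]]
    by (simp add: vimage_def)
  show "affine U" using W(2) unfolding U_def affine_def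
    by (simp add: linear_add[OF lin] linear_scale[OF lin])
  show "affine_action \<pi> b g ` U \<subseteq> U"
    unfolding U_def using inv
    by (auto simp: affine_action_def linear_add[OF lin] orth_proj_rep[OF V])
qed

lemma irreducible_imp_projections_unbounded:
  assumes irreducible_action
  shows projections_unbounded
  unfolding projections_unbounded_def
proof (intro allI impI notI, elim conjE)
  fix V assume V: "subrep \<pi> V" "V \<noteq> {0}" and bdd: "bounded (range (\<lambda>g. orth_proj V (b g)))"
  note V' = subrepD(1,2)[OF V(1)]
  obtain v where v: "v \<in> V" "\<And>g. \<pi> g v + orth_proj V (b g) = v"
  proof (rule bounded_cocycle_fixed_point[OF V(1) orth_proj_cocycle[OF V(1) cocycle] _ bdd])
    show "range (\<lambda>g. orth_proj V (b g)) \<subseteq> V" using orth_proj_in[OF V'] by blast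
  qed (rule that)
  define U where "U = {x. orth_proj V x \<in> {v}}"
  have U: "closed U" "affine U" "affine_action \<pi> b g ` U \<subseteq> U" for g
    unfolding U_def using orth_proj_preimage_invariant[OF V(1), of "{v}"] v(2) by auto
  \<comment> \<open>Adding a non-zero vector of \<open>V\<close> to the fixed point leaves the
    preimage, so \<open>U\<close> is proper.\<close>
  obtain w where w: "w \<in> V" "w \<noteq> 0" using V(2) V'(2) subspace_0 by blast
  have "v \<in> U" unfolding U_def using v(1) orth_proj_ident[OF V'] by simp
  moreover have "v + w \<notin> U" unfolding U_def using v(1) w V' by (simp add: orth_proj_ident subspace_add)
  moreover have "U = UNIV" using \<open>v \<in> U\<close> U by (intro irreducible_action_onD[OF assms]) auto
  ultimately show False by blast
qed

lemma projections_unbounded_imp_irreducible: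
  assumes projections_unbounded
  shows irreducible_action
  unfolding irreducible_action_on_def
proof (intro notI, elim exE conjE)
  fix W :: "'h set"
  assume "W \<noteq> {}"
  then obtain v where "v \<in> W" by blast
  moreover assume "closed W" "affine W" "W \<subset> UNIV" "\<forall>g. affine_action \<pi> b g ` W \<subseteq> W"
  ultimately have W: "v \<in> W" "closed W" "affine W" "W \<subset> UNIV"
    "\<forall>g. affine_action \<pi> b g ` W \<subseteq> W" by simp_all
  define V where "V = (\<lambda>x. x - v) ` W"
  have act: "\<pi> g w + b g \<in> W" if "w \<in> W" for g w
    using W(5) that by (auto simp: affine_action_def)
  have "\<pi> g (w - v) \<in> V" if "w \<in> W" for g w
  proof -
    \<comment> \<open>The difference of the images of \<open>w\<close> and \<open>v\<close> is
      \<open>\<pi> g (w - v)\<close>; as a difference of two points of \<open>W\<close> it may be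
      added to \<open>v\<close> within \<open>W\<close>.\<close>
    have "v + 1 *\<^sub>R ((\<pi> g w + b g) - (\<pi> g v + b g)) \<in> W"
      using mem_affine_3_minus[OF W(3,1) act[OF that] act[OF W(1)]] .
    then show ?thesis unfolding V_def
      by (auto simp: linear_diff[OF linear_rep] image_iff intro!: bexI[of _ "v + (\<pi> g w - \<pi> g v)"])
  qed
  then have "\<pi> g ` V \<subseteq> V" for g by (auto simp: V_def)
  moreover have "subspace V" "closed V" unfolding V_def
    by (rule affine_diffs_subspace_subtract[OF W(3,1)], rule closed_translation_subtract[OF W(2)])
  ultimately have V: "subrep \<pi> V" by (simp add: subrep_def)
  have "V \<noteq> UNIV"
  proof
    assume "V = UNIV"
    then have "x - v \<in> V" for x by blast
    then have "x \<in> W" for x unfolding V_def by (auto simp: image_iff)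
    then show False using W(4) by blast
  qed
  then obtain u where u: "u \<noteq> 0" "\<And>z. z \<in> V \<Longrightarrow> u \<bullet> z = 0"
    using closed_proper_subspace_orth_witness subrepD[OF V] by metis
  have V0: "subrep \<pi> (V\<^sup>\<bottom>)" using subrep_orthogonal_comp[OF V] .
  note V0' = subrepD(1,2)[OF V0]
  note lin = linear_orth_proj[OF V0']
  have "u \<in> V\<^sup>\<bottom>" using u(2) by (auto simp: orthogonal_comp_def orthogonal_def inner_commute)
  then have ne: "V\<^sup>\<bottom> \<noteq> {0}" using u(1) by blast
  have P0: "orth_proj (V\<^sup>\<bottom>) x = 0" if "x \<in> V" for x
    using that V0' by (intro orth_proj_eqI) (auto simp: orthogonal_comp_def orthogonal_def subspace_0)
  \<comment> \<open>The displacement of \<open>v\<close> lies in the direction \<open>V\<close> and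
    projects to zero, so on the complement \<open>b\<close> agrees with the projection of
    \<open>v - \<pi> g v\<close>.\<close>
  have "norm (orth_proj (V\<^sup>\<bottom>) (b g)) \<le> 2 * norm v" for g
  proof -
    have "\<pi> g v + b g - v \<in> V" unfolding V_def using act[OF W(1)] by blast
    from P0[OF this] have "orth_proj (V\<^sup>\<bottom>) (b g) = orth_proj (V\<^sup>\<bottom>) (v - \<pi> g v)"
      by (simp add: linear_add[OF lin] linear_diff[OF lin] algebra_simps)
    also have "norm \<dots> \<le> norm (v - \<pi> g v)" by (rule norm_orth_proj_le[OF V0'])
    also have "\<dots> \<le> 2 * norm v" using norm_triangle_ineq4[of v "\<pi> g v"] by (simp add: rep_norm)
    finally show ?thesis .
  qed
  then have "bounded (range (\<lambda>g. orth_proj (V\<^sup>\<bottom>) (b g)))" unfolding bounded_iff by blast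
  then show False using assms V0 ne unfolding projections_unbounded_def by blast
qed

abbreviation no_bounded_summand :: bool where
  "no_bounded_summand \<equiv>
    (\<forall>\<psi>\<^sub>0 \<psi>\<^sub>1. cond_neg_type \<psi>\<^sub>0 \<and> cond_neg_type \<psi>\<^sub>1 \<and>
       (\<lambda>g. (norm (b g))\<^sup>2) = (\<lambda>g. \<psi>\<^sub>0 g + \<psi>\<^sub>1 g) \<and> \<psi>\<^sub>0 \<noteq> (\<lambda>_. 0) \<longrightarrow> \<not> bounded (range \<psi>\<^sub>0))"

text \<open>Pythagoras splits the squared norm of \<open>b\<close> into those of its projection
  \<open>p\<close> and of \<open>b - p\<close>, both cocycles. A bounded \<open>p\<close> would give
  a bounded summand, non-zero because \<open>b\<close> has total image.\<close>

lemma no_bounded_summand_imp_projections_unbounded: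
  assumes total: "total_subset (range b)" and no_bounded_summand
  shows projections_unbounded
  unfolding projections_unbounded_def
proof (intro allI impI notI, elim conjE)
  fix V assume V: "subrep \<pi> V" "V \<noteq> {0}" and bdd: "bounded (range (\<lambda>g. orth_proj V (b g)))"
  note V' = subrepD(1,2)[OF V(1)]
  define p where "p g = orth_proj V (b g)" for g
  have p: "p \<in> cocycles \<pi>" unfolding p_def using orth_proj_cocycle[OF V(1) cocycle] .
  have q: "(\<lambda>g. b g - p g) \<in> cocycles \<pi>" using cocycle_diff[OF cocycle p] .
  have split: "(norm (b g))\<^sup>2 = (norm (p g))\<^sup>2 + (norm (b g - p g))\<^sup>2" for g
  proof -
    have "(b g - p g) \<bullet> p g = 0"
      unfolding p_def by (rule orth_proj_orth[OF V' orth_proj_in[OF V']])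
    then show ?thesis unfolding power2_norm_eq_inner
      by (simp add: inner_diff_left inner_diff_right inner_commute)
  qed
  have "(\<lambda>g. (norm (p g))\<^sup>2) \<noteq> (\<lambda>_. 0)"
  proof
    assume "(\<lambda>g. (norm (p g))\<^sup>2) = (\<lambda>_. 0)"
    then have p0: "p g = 0" for g by (metis norm_eq_zero power_eq_0_iff)
    \<comment> \<open>If \<open>p\<close> vanished, all values of \<open>b\<close> would be
      orthogonal to \<open>V\<close>, which totality excludes for non-zero \<open>V\<close>.\<close>
    have "w = 0" if "w \<in> V" for w
    proof (rule total_inner_eqI[OF total])
      fix y assume "y \<in> range b"
      then obtain g where "y = b g" by blast
      then show "w \<bullet> y = 0 \<bullet> y"
        using orth_proj_orth[OF V' that, of "b g"] p0[of g] by (simp add: p_def inner_commute)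
    qed
    then show False using V(2) subspace_0[OF V'(2)] by blast
  qed
  then have "\<not> bounded (range (\<lambda>g. (norm (p g))\<^sup>2))"
    using assms(2) cond_neg_type_norm_sq[OF p] cond_neg_type_norm_sq[OF q] split by blast
  moreover have "bounded (range (\<lambda>g. (norm (p g))\<^sup>2))"
  proof -
    obtain B where "\<And>g. norm (p g) \<le> B" using bdd unfolding bounded_iff p_def by auto
    then have "norm ((norm (p g))\<^sup>2) \<le> B\<^sup>2" for g by (simp add: power_mono)
    then show ?thesis unfolding bounded_iff by blast
  qed
  ultimately show False by blast
qed

text \<open>The kernels of \<open>\<psi>\<^sub>0\<close> and \<open>\<psi>\<^sub>1\<close> are
  positive and add up to the Gram kernel of \<open>b\<close>, so the first one comes from an
  operator between 0 and 1.\<close>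

lemma projections_unbounded_imp_no_bounded_summand:
  assumes total: "total_subset (range b)" and projections_unbounded
  shows no_bounded_summand
proof (intro allI impI notI, elim conjE)
  fix \<psi>\<^sub>0 \<psi>\<^sub>1 :: "'g \<Rightarrow> real"
  assume \<psi>\<^sub>0: "cond_neg_type \<psi>\<^sub>0" and \<psi>\<^sub>1: "cond_neg_type \<psi>\<^sub>1"
    and sum: "(\<lambda>g. (norm (b g))\<^sup>2) = (\<lambda>g. \<psi>\<^sub>0 g + \<psi>\<^sub>1 g)"
    and nz: "\<psi>\<^sub>0 \<noteq> (\<lambda>_. 0)" and bdd: "bounded (range \<psi>\<^sub>0)"
  have sum': "(norm (b g))\<^sup>2 = \<psi>\<^sub>0 g + \<psi>\<^sub>1 g" for g using sum by (rule fun_cong)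
  have z: "\<psi>\<^sub>0 0 = 0" and ev: "\<psi>\<^sub>0 (- g) = \<psi>\<^sub>0 g" for g
    using \<psi>\<^sub>0 by (simp_all add: cond_neg_type_def)
  define K where "K i j = (\<psi>\<^sub>0 i + \<psi>\<^sub>0 j - \<psi>\<^sub>0 (- i + j)) / 2" for i j
  define K1 where "K1 i j = (\<psi>\<^sub>1 i + \<psi>\<^sub>1 j - \<psi>\<^sub>1 (- i + j)) / 2" for i j
  have K_sum: "b i \<bullet> b j = K i j + K1 i j" for i j
    unfolding cocycle_inner[OF cocycle] K_def K1_def by (simp add: sum' field_simps)
  have K_sym: "K i j = K j i" for i j
    using ev[of "- i + j"] unfolding K_def by (simp add: minus_add)
  have pos: "0 \<le> (\<Sum>k<n. \<Sum>m<n. l k * l m * K (i k) (i m))" for n :: nat and l i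
    unfolding K_def by (rule cond_neg_type_kernel_nonneg[OF \<psi>\<^sub>0])
  have le: "(\<Sum>k<n. \<Sum>m<n. l k * l m * K (i k) (i m)) \<le> (norm (\<Sum>k<n. l k *\<^sub>R b (i k)))\<^sup>2"
    for n :: nat and l i
  proof -
    have "(norm (\<Sum>k<n. l k *\<^sub>R b (i k)))\<^sup>2 = (\<Sum>k<n. l k * (\<Sum>m<n. l m * (b (i k) \<bullet> b (i m))))"
      by (simp only: power2_norm_eq_inner inner_sum_left inner_scaleR_left) (simp add: inner_sum_right)
    also have "\<dots> = (\<Sum>k<n. \<Sum>m<n. l k * l m * K (i k) (i m) + l k * l m * K1 (i k) (i m))"
      by (simp add: sum_distrib_left K_sum algebra_simps)
    also have "\<dots> = (\<Sum>k<n. \<Sum>m<n. l k * l m * K (i k) (i m)) + (\<Sum>k<n. \<Sum>m<n. l k * l m * K1 (i k) (i m))"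
      by (simp add: sum.distrib)
    finally show ?thesis
      using cond_neg_type_kernel_nonneg[OF \<psi>\<^sub>1, of l i n] unfolding K1_def by simp
  qed
  obtain A where A: "linear A" "\<And>x y. A x \<bullet> y = x \<bullet> A y" "\<And>x. 0 \<le> A x \<bullet> x"
    "\<And>x. A x \<bullet> x \<le> (norm x)\<^sup>2" and AK: "\<And>i j. A (b i) \<bullet> b j = K i j"
  proof (rule positive_kernel_operator[of K b])
    show "closure (span (range b)) = UNIV" using total by (simp add: total_subset_def)
  qed (rule K_sym pos le that | assumption)+
  have bA: "bounded_linear A" using positive_contraction_bounded_linear[OF A] .
  have A\<psi>: "A (b g) \<bullet> b g = \<psi>\<^sub>0 g" for g unfolding AK K_def by (simp add: z)
  \<comment> \<open>Since \<open>\<pi> k (b g)\<close> is the difference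
    \<open>b (k + g) - b k\<close>, both sides pair with \<open>b h\<close> to differences of kernel
    values, and these agree by evenness of \<open>\<psi>\<^sub>0\<close>.\<close>
  have comm_b: "A (\<pi> k (b g)) = \<pi> k (A (b g))" for k g
  proof (rule total_inner_eqI[OF total])
    fix y assume "y \<in> range b"
    then obtain h where y: "y = b h" by blast
    have assoc: "- (k + g) + h = - g + (- k + h)" by (simp only: minus_add add.assoc)
    have ev2: "\<psi>\<^sub>0 (- g + - k) = \<psi>\<^sub>0 (k + g)" using ev[of "k + g"] by (simp only: minus_add)
    have "A (\<pi> k (b g)) \<bullet> y = K (k + g) h - K k h"
    proof -
      have "\<pi> k (b g) = b (k + g) - b k" by (simp add: cocycle_add[OF cocycle])
      then show ?thesis by (simp add: y linear_diff[OF A(1)] inner_diff_left AK)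
    qed
    also have "\<dots> = K g (- k + h) - K g (- k)"
      unfolding K_def assoc ev2 ev[of k] by (simp add: field_simps)
    also have "\<dots> = \<pi> k (A (b g)) \<bullet> y"
    proof -
      have "\<pi> (- k) (b h) = b (- k + h) - b (- k)" by (simp only: cocycle_add[OF cocycle]) simp
      then show ?thesis by (simp add: y rep_adjoint inner_diff_right AK)
    qed
    finally show "A (\<pi> k (b g)) \<bullet> y = \<pi> k (A (b g)) \<bullet> y" .
  qed
  have comm: "\<pi> k (A x) = A (\<pi> k x)" for k x
  proof (rule total_linear_eqI[OF total, of "\<lambda>x. \<pi> k (A x)" "\<lambda>x. A (\<pi> k x)"])
    show "bounded_linear (\<lambda>x. \<pi> k (A x))" "bounded_linear (\<lambda>x. A (\<pi> k x))"
      using bounded_linear_compose[OF bounded_linear_rep bA] bounded_linear_compose[OF bA bounded_linear_rep]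
      by auto
  qed (auto simp: comm_b)
  obtain g0 where "\<psi>\<^sub>0 g0 \<noteq> 0" using nz by blast
  then have "A (b g0) \<bullet> b g0 \<noteq> 0" by (simp add: A\<psi>)
  then obtain \<epsilon> V where V: "\<epsilon> > 0" "closed V" "subspace V" "V \<noteq> {0}"
    and below: "\<And>x. x \<in> V \<Longrightarrow> \<epsilon> * (norm x)\<^sup>2 \<le> A x \<bullet> x"
    and inv: "\<And>L x. bounded_linear L \<Longrightarrow> (\<And>x. L (A x) = A (L x)) \<Longrightarrow> x \<in> V \<Longrightarrow> L x \<in> V"
    using positive_operator_bounded_below_subspace[OF A] by metis
  have "subrep \<pi> V" using V inv[OF bounded_linear_rep comm] by (auto simp: subrep_def)
  moreover have "bounded (range (\<lambda>g. orth_proj V (b g)))"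
  proof -
    obtain B where B: "\<And>g. \<psi>\<^sub>0 g \<le> B" using bdd unfolding bounded_iff by (auto intro: order_trans[OF abs_ge_self])
    \<comment> \<open>\<open>A\<close> is symmetric and maps \<open>V\<close> into itself, so the
      cross terms between \<open>p\<close> and \<open>q\<close> vanish and \<open>\<epsilon>\<close>
      times the squared norm of \<open>p\<close> is at most \<open>\<psi>\<^sub>0 g\<close>.\<close>
    have "norm (orth_proj V (b g)) \<le> sqrt (B / \<epsilon>)" for g
    proof -
      define p q where "p = orth_proj V (b g)" and "q = b g - p"
      have p: "p \<in> V" unfolding p_def using V by (intro orth_proj_in)
      have "A p \<in> V" using inv[OF bA _ p] by simp
      then have "q \<bullet> A p = 0" unfolding p_def q_def using V by (intro orth_proj_orth) auto
      moreover have "b g = p + q" by (simp add: q_def)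
      ultimately have "A (b g) \<bullet> b g = A p \<bullet> p + A q \<bullet> q"
        using A(2)[of q p] by (simp add: linear_add[OF A(1)] inner_add_left inner_add_right inner_commute)
      then have "\<epsilon> * (norm p)\<^sup>2 \<le> B" using below[OF p] A(3)[of q] A\<psi>[of g] B[of g] by simp
      then have "(norm p)\<^sup>2 \<le> B / \<epsilon>" using V(1) by (simp add: field_simps)
      then show ?thesis unfolding p_def by (rule real_le_rsqrt)
    qed
    then show ?thesis unfolding bounded_iff by blast
  qed
  ultimately show False using assms(2) V(4) unfolding projections_unbounded_def by blast
qed

lemma irreducible_iff_no_bounded_summand:
  "irreducible_action \<longleftrightarrow> total_subset (range b) \<and> no_bounded_summand"
  using irreducible_imp_total irreducible_imp_projections_unbounded projections_unbounded_imp_irreducible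
    no_bounded_summand_imp_projections_unbounded projections_unbounded_imp_no_bounded_summand
  by blast

text \<open>A proper invariant subspace of a projected action has a proper invariant preimage.
  Conversely, the projection to the whole space is the action itself.\<close>

lemma irreducible_iff_projected:
  assumes not_coboundary: "\<not> (\<exists>v. b = coboundary \<pi> v)"
  shows "irreducible_action \<longleftrightarrow>
    (\<forall>V. subrep \<pi> V \<and> V \<noteq> {0} \<longrightarrow> irreducible_action_on V (projected_action \<pi> b V))"
proof
  assume irr: irreducible_action
  show "\<forall>V. subrep \<pi> V \<and> V \<noteq> {0} \<longrightarrow> irreducible_action_on V (projected_action \<pi> b V)"
  proof (intro allI impI, elim conjE)
    fix V assume V: "subrep \<pi> V"
    note V' = subrepD(1,2)[OF V]
    show "irreducible_action_on V (projected_action \<pi> b V)"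
      unfolding irreducible_action_on_def
    proof (intro notI, elim exE conjE)
      fix W assume W: "W \<noteq> {}" "closed W" "affine W" "W \<subset> V" "\<forall>g. projected_action \<pi> b V g ` W \<subseteq> W"
      have inv: "\<pi> g w + orth_proj V (b g) \<in> W" if "w \<in> W" for g w
        using W(5) that by (auto simp: projected_action_def affine_action_def)
      define U where "U = {x. orth_proj V x \<in> W}"
      have U: "closed U" "affine U" "\<And>g. affine_action \<pi> b g ` U \<subseteq> U"
        unfolding U_def using orth_proj_preimage_invariant[OF V W(2,3) inv] by blast+
      have WU: "w \<in> U \<longleftrightarrow> w \<in> W" if "w \<in> V" for w
        using that by (simp add: U_def orth_proj_ident[OF V'])
      then have "U \<noteq> {}" using W(1,4) by blast
      then have "U = UNIV" using U by (intro irreducible_action_onD[OF irr]) auto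
      then show False using WU W(4) by blast
    qed
  qed
next
  assume "\<forall>V. subrep \<pi> V \<and> V \<noteq> {0} \<longrightarrow> irreducible_action_on V (projected_action \<pi> b V)"
  moreover have "subrep \<pi> UNIV" by (simp add: subrep_def)
  \<comment> \<open>The whole space counts as a non-zero sub-representation because \<open>b\<close>
    is not a coboundary: on the zero space every cocycle equals
    \<open>coboundary \<pi> 0\<close>.\<close>
  moreover have "(UNIV :: 'h set) \<noteq> {0}"
  proof
    assume "(UNIV :: 'h set) = {0}"
    then have "x = y" for x y :: 'h by (metis UNIV_I singletonD)
    then have "b = coboundary \<pi> 0" by blast
    then show False using not_coboundary by blast
  qed
  ultimately have "irreducible_action_on UNIV (projected_action \<pi> b UNIV)" by blast
  then show irreducible_action by (simp add: projected_action_def orth_proj_ident)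
qed

end

theorem proposition2p1:
  fixes \<pi> :: "'g::topological_group_add \<Rightarrow> 'h::{real_inner,complete_space} \<Rightarrow> 'h"
    and b :: "'g \<Rightarrow> 'h"
    and \<alpha> :: "'g \<Rightarrow> 'h \<Rightarrow> 'h"
    and \<psi> :: "'g \<Rightarrow> real"
    and A1 A2 A3 A4 A5 A6 :: bool
  assumes rep: "unitary_rep \<pi>"
    and cocycle: "b \<in> cocycles \<pi>"
    and not_coboundary: "\<not> (\<exists>v. b = coboundary \<pi> v)"
    and alpha: "\<alpha> = affine_action \<pi> b"
    and psi: "\<psi> = (\<lambda>g. (norm (b g))\<^sup>2)"
    and A1: "A1 \<longleftrightarrow> irreducible_action_on UNIV \<alpha>"
    and A2: "A2 \<longleftrightarrow> (\<forall>v. total_subset (range (\<lambda>g. b g + coboundary \<pi> v g)))"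
    and A3: "A3 \<longleftrightarrow>
      (\<forall>V\<^sub>0 V\<^sub>1 b\<^sub>0 b\<^sub>1. direct_sum_decomposition \<pi> V\<^sub>0 V\<^sub>1 \<and> V\<^sub>0 \<noteq> {0} \<and>
         (\<forall>g. b\<^sub>0 g \<in> V\<^sub>0 \<and> b\<^sub>1 g \<in> V\<^sub>1 \<and> b g = b\<^sub>0 g + b\<^sub>1 g)
         \<longrightarrow> \<not> bounded (range b\<^sub>0))"
    and A4: "A4 \<longleftrightarrow>
      total_subset (range b) \<and>
      (\<forall>\<psi>\<^sub>0 \<psi>\<^sub>1. cond_neg_type \<psi>\<^sub>0 \<and> cond_neg_type \<psi>\<^sub>1 \<and>
         \<psi> = (\<lambda>g. \<psi>\<^sub>0 g + \<psi>\<^sub>1 g) \<and> \<psi>\<^sub>0 \<noteq> (\<lambda>_. 0)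
         \<longrightarrow> \<not> bounded (range \<psi>\<^sub>0))"
    and A5: "A5 \<longleftrightarrow>
      total_subset (range b) \<and>
      (\<exists>F. cone_face F cone_C \<and> cone_face F cone_Cu \<and> \<psi> \<in> F)"
    and A6: "A6 \<longleftrightarrow>
      (\<forall>V\<^sub>0. subrep \<pi> V\<^sub>0 \<and> V\<^sub>0 \<noteq> {0} \<longrightarrow>
         irreducible_action_on V\<^sub>0 (projected_action \<pi> b V\<^sub>0))"
  shows "(A1 \<longleftrightarrow> A2) \<and> (A1 \<longleftrightarrow> A3) \<and> (A1 \<longleftrightarrow> A4) \<and> (A1 \<longleftrightarrow> A5) \<and> (A1 \<longleftrightarrow> A6)"
proof -
  interpret affine_isometric_action \<pi> b by unfold_locales (fact rep cocycle)+
  have "A1 \<longleftrightarrow> irreducible_action" unfolding A1 alpha ..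
  moreover have "irreducible_action \<longleftrightarrow> A2" unfolding A2 by (rule irreducible_iff_total)
  moreover have "irreducible_action \<longleftrightarrow> A3"
    unfolding A3 projections_unbounded_iff_decompositions[symmetric]
    using irreducible_imp_projections_unbounded projections_unbounded_imp_irreducible by blast
  moreover have "irreducible_action \<longleftrightarrow> A4"
    unfolding A4 psi by (rule irreducible_iff_no_bounded_summand)
  moreover have "A4 \<longleftrightarrow> A5"
    unfolding A4 A5 psi common_face_iff[OF cond_neg_type_norm_sq[OF cocycle]] ..
  moreover have "irreducible_action \<longleftrightarrow> A6"
    unfolding A6 by (rule irreducible_iff_projected[OF not_coboundary])
  ultimately show ?thesis by blast
qed

end
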